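(* Let $d\ge 2$ be a constant and let $c\ge 1$ be an integer constant ($c\in O(1)$). Let $G=(V,E)$ be a $(d,c)$-grid graph. For every constant $\alpha\in\left(\max\{\frac{d+1}{d+2},\frac45\},1\right)$ there exists a Las Vegas MPC algorithm with local memory $\Theta(s)\subseteq\Theta(|V|^{\alpha})$ per machine which, with high probability, computes all the connected components of $G$ in $O(1)$ rounds; specifically, it assigns to each node the ID of the connected component of $G$ to which the node belongs.
   Context: A $(d,c)$-grid graph ($d$-dimensional $c$-penetration grid graph) is a graph $G=(V,E)$ where $d\ge 2$ is a constant, $c\ge1$ is an integer, every node of $V$ is a point with integer coordinates in $\mathbb{N}^d$, and every edge $(u,v)\in E$ satisfies $0<\|u-v\|_\infty\le c$. MPC model: the input of size $N$ (here $N=\Theta(|V|+|E|)$) is evenly distributed over $m$ machines, each with local memory $\Theta(s)$ where $s=N/m=N^{\alpha}$ for a constant $\alpha\in(0,1)$; computation proceeds in synchronous rounds, in each of which every machine first sends and receives $O(s)$ words in total and then performs local computation on its memory. A Las Vegas algorithm never outputs a wrong answer; "with high probability" means with probability at least $1-1/N^{\Omega(1)}$. *)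

theory Defs
  imports "HOL-Probability.Probability" "HOL-Probability.Product_PMF"
begin

section \<open>Grid graphs\<close>

text \<open>A point of \<open>\<nat>\<^sup>d\<close> is the list of its \<open>d\<close> coordinates. Edges are undirected, hence
  unordered pairs.\<close>

type_synonym point = "nat list"

definition linf_dist :: "nat \<Rightarrow> point \<Rightarrow> point \<Rightarrow> int" where
  "linf_dist d u v = Max ((\<lambda>i. \<bar>int (u ! i) - int (v ! i)\<bar>) ` {..<d})"

definition grid_graph :: "nat \<Rightarrow> nat \<Rightarrow> point set \<Rightarrow> point set set \<Rightarrow> bool" where
  "grid_graph d c V E \<longleftrightarrow>
     finite V \<and> (\<forall>v\<in>V. length v = d) \<and>
     (\<forall>e\<in>E. \<exists>u\<in>V. \<exists>v\<in>V. e = {u, v} \<and> 0 < linf_dist d u v \<and> linf_dist d u v \<le> int c)"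

definition connectivity :: "point set \<Rightarrow> point set set \<Rightarrow> (point \<times> point) set" where
  "connectivity V E = {(u, v). {u, v} \<in> E}\<^sup>* \<inter> (V \<times> V)"

definition connected_components :: "point set \<Rightarrow> point set set \<Rightarrow> point set set" where
  "connected_components V E = V // connectivity V E"

text \<open>The set of pairs (node, label) is an assignment of component IDs; any choice of pairwise
  distinct IDs for the components is admissible.\<close>

definition labels_components :: "point set \<Rightarrow> point set set \<Rightarrow> (point \<times> nat) set \<Rightarrow> bool" where
  "labels_components V E L \<longleftrightarrow>
     (\<exists>ID. inj_on ID (connected_components V E) \<and>
           L = {(v, ID K) | v K. K \<in> connected_components V E \<and> v \<in> K})"


section \<open>The MPC model\<close>

text \<open>The parameter \<open>N\<close> is the input size and \<open>\<alpha>\<close> the exponent of the local memory: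
  \<open>s = N\<^sup>\<alpha>\<close>, \<open>m = N / s\<close>. Machines are numbered \<open>0, \<dots>, m - 1\<close>.\<close>

definition local_space :: "real \<Rightarrow> nat \<Rightarrow> real" where
  "local_space \<alpha> N = real N powr \<alpha>"

definition num_machines :: "real \<Rightarrow> nat \<Rightarrow> nat" where
  "num_machines \<alpha> N = nat \<lceil>real N / local_space \<alpha> N\<rceil>"

text \<open>Memory contents and message payloads are lists of words (natural numbers, whose size is
  bounded below). The first two arguments of every component of an algorithm are \<open>N\<close> and the
  number of the machine, the third is the content of its memory:
  \<^item> \<open>msgs\<close> yields the messages (destination, payload) sent at the beginning of a round;
  \<^item> \<open>compute\<close> maps the memory and the received messages (sender, payload) to the distribution of
    the new memory;
  \<^item> \<open>result\<close> yields \<^const>\<open>None\<close> while the machine is not ready to terminate, and otherwise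
    its share of the output, as a list of (node, ID of the component of the node).

  As usual in this model, local computation is not restricted.\<close>

record mpc_algorithm =
  msgs :: "nat \<Rightarrow> nat \<Rightarrow> nat list \<Rightarrow> (nat \<times> nat list) list"
  compute :: "nat \<Rightarrow> nat \<Rightarrow> nat list \<Rightarrow> (nat \<times> nat list) list \<Rightarrow> nat list pmf"
  result :: "nat \<Rightarrow> nat \<Rightarrow> nat list \<Rightarrow> (point \<times> nat) list option"

type_synonym config = "nat \<Rightarrow> nat list"

definition inbox :: "mpc_algorithm \<Rightarrow> real \<Rightarrow> nat \<Rightarrow> config \<Rightarrow> nat \<Rightarrow> (nat \<times> nat list) list" where
  "inbox A \<alpha> N \<sigma> j =
     concat (map (\<lambda>i. map (\<lambda>(k, p). (i, p)) (filter (\<lambda>(k, p). k = j) (msgs A N i (\<sigma> i))))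
                 [0..<num_machines \<alpha> N])"

text \<open>Each message is charged one word for its address in addition to its payload.\<close>

definition volume :: "(nat \<times> nat list) list \<Rightarrow> nat" where
  "volume M = (\<Sum>(k, p)\<leftarrow>M. length p + 1)"

definition terminated :: "mpc_algorithm \<Rightarrow> real \<Rightarrow> nat \<Rightarrow> config \<Rightarrow> bool" where
  "terminated A \<alpha> N \<sigma> \<longleftrightarrow> (\<forall>i<num_machines \<alpha> N. result A N i (\<sigma> i) \<noteq> None)"

definition answer :: "mpc_algorithm \<Rightarrow> real \<Rightarrow> nat \<Rightarrow> config \<Rightarrow> (point \<times> nat) set" where
  "answer A \<alpha> N \<sigma> = (\<Union>i<num_machines \<alpha> N. set (the (result A N i (\<sigma> i))))"

text \<open>The machines use independent randomness; a terminated computation stands still.\<close>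

definition mpc_round :: "mpc_algorithm \<Rightarrow> real \<Rightarrow> nat \<Rightarrow> config \<Rightarrow> config pmf" where
  "mpc_round A \<alpha> N \<sigma> =
     (if terminated A \<alpha> N \<sigma> then return_pmf \<sigma>
      else Pi_pmf {..<num_machines \<alpha> N} [] (\<lambda>i. compute A N i (\<sigma> i) (inbox A \<alpha> N \<sigma> i)))"

primrec mpc_run :: "mpc_algorithm \<Rightarrow> real \<Rightarrow> nat \<Rightarrow> config \<Rightarrow> nat \<Rightarrow> config pmf" where
  "mpc_run A \<alpha> N \<sigma> 0 = return_pmf \<sigma>"
| "mpc_run A \<alpha> N \<sigma> (Suc t) = bind_pmf (mpc_run A \<alpha> N \<sigma> t) (mpc_round A \<alpha> N)"

text \<open>No machine exceeds \<open>cap\<close> words of memory, communication per round, or output,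
  and no word exceeds \<open>W\<close>.\<close>

definition within_limits :: "mpc_algorithm \<Rightarrow> real \<Rightarrow> nat \<Rightarrow> real \<Rightarrow> nat \<Rightarrow> config \<Rightarrow> bool" where
  "within_limits A \<alpha> N cap W \<sigma> \<longleftrightarrow>
     (\<forall>i<num_machines \<alpha> N.
        real (length (\<sigma> i)) \<le> cap \<and> (\<forall>w\<in>set (\<sigma> i). w \<le> W) \<and>
        (\<not> terminated A \<alpha> N \<sigma> \<longrightarrow>
           real (volume (msgs A N i (\<sigma> i)) + volume (inbox A \<alpha> N \<sigma> i)) \<le> cap \<and>
           (\<forall>(k, p)\<in>set (msgs A N i (\<sigma> i)). k < num_machines \<alpha> N \<and> (\<forall>w\<in>set p. w \<le> W))) \<and>
        (\<forall>L. result A N i (\<sigma> i) = Some L \<longrightarrow>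
           real (\<Sum>(v, a)\<leftarrow>L. length v + 1) \<le> cap \<and>
           (\<forall>(v, a)\<in>set L. a \<le> W \<and> (\<forall>w\<in>set v. w \<le> W))))"


section \<open>Graphs as MPC inputs\<close>

definition graph_size :: "point set \<Rightarrow> point set set \<Rightarrow> nat" where
  "graph_size V E = card V + card E"

datatype item = Node point | Edge point point

fun item_words :: "item \<Rightarrow> nat list" where
  "item_words (Node v) = 0 # v"
| "item_words (Edge u v) = 1 # u @ v"

fun denotes :: "item \<Rightarrow> point + point set" where
  "denotes (Node v) = Inl v"
| "denotes (Edge u v) = Inr {u, v}"

text \<open>\<open>D i\<close> is the part of the input that machine \<open>i\<close> receives. Every node and every edge
  (in one of its two orientations) is given to exactly one machine; apart from evenness the
  placement is arbitrary.\<close>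

definition even_distribution ::
    "real \<Rightarrow> point set \<Rightarrow> point set set \<Rightarrow> (nat \<Rightarrow> item list) \<Rightarrow> bool" where
  "even_distribution \<alpha> V E D \<longleftrightarrow>
     (let N = graph_size V E; m = num_machines \<alpha> N; items = concat (map D [0..<m]) in
        distinct (map denotes items) \<and>
        set (map denotes items) = Inl ` V \<union> Inr ` E \<and>
        (\<forall>i<m. \<lfloor>real N / real m\<rfloor> \<le> int (length (D i)) \<and> int (length (D i)) \<le> \<lceil>real N / real m\<rceil>))"

definition initial_config :: "(nat \<Rightarrow> item list) \<Rightarrow> config" where
  "initial_config D i = concat (map item_words (D i))"

text \<open>Coordinates are unbounded, so a word has \<open>O(log (N + U))\<close> bits where \<open>U\<close> is the
  largest coordinate in the input: it can hold a coordinate or an index into the input.\<close>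

definition word_limit :: "nat \<Rightarrow> point set \<Rightarrow> point set set \<Rightarrow> nat" where
  "word_limit \<kappa> V E = (graph_size V E + Max (insert 0 (\<Union>v\<in>V. set v)) + 2) ^ \<kappa>"


section \<open>Las Vegas algorithms for connected components\<close>

text \<open>The limits have to be respected, and a wrong answer is excluded, in every possible run and
  not only with high probability.\<close>

definition respects_limits ::
    "mpc_algorithm \<Rightarrow> real \<Rightarrow> real \<Rightarrow> nat \<Rightarrow> point set \<Rightarrow> point set set \<Rightarrow> (nat \<Rightarrow> item list) \<Rightarrow> bool"
where
  "respects_limits A \<alpha> C \<kappa> V E D \<longleftrightarrow>
     (let N = graph_size V E in
        \<forall>t. \<forall>\<sigma> \<in> set_pmf (mpc_run A \<alpha> N (initial_config D) t).
           within_limits A \<alpha> N (C * local_space \<alpha> N) (word_limit \<kappa> V E) \<sigma>)"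

definition las_vegas_components ::
    "mpc_algorithm \<Rightarrow> real \<Rightarrow> point set \<Rightarrow> point set set \<Rightarrow> (nat \<Rightarrow> item list) \<Rightarrow> bool" where
  "las_vegas_components A \<alpha> V E D \<longleftrightarrow>
     (let N = graph_size V E in
        \<forall>t. \<forall>\<sigma> \<in> set_pmf (mpc_run A \<alpha> N (initial_config D) t).
           terminated A \<alpha> N \<sigma> \<longrightarrow> labels_components V E (answer A \<alpha> N \<sigma>))"

definition success_prob ::
    "mpc_algorithm \<Rightarrow> real \<Rightarrow> point set \<Rightarrow> point set set \<Rightarrow> (nat \<Rightarrow> item list) \<Rightarrow> nat \<Rightarrow> real" where
  "success_prob A \<alpha> V E D R =
     (let N = graph_size V E in
        measure_pmf.prob (mpc_run A \<alpha> N (initial_config D) R)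
          {\<sigma>. terminated A \<alpha> N \<sigma> \<and> labels_components V E (answer A \<alpha> N \<sigma>)})"

end

theory Submission
  imports Defs "HOL-Library.Nat_Bijection"
begin

text \<open>A deterministic algorithm suffices. Cut space into cubical cells of side \<open>m = N / s\<close>. A node has few
  neighbours, so a cell contains \<open>O(m\<^sup>d) \<subseteq> O(s)\<close> items; and an edge, having length at most \<open>c\<close>, is cut
  by at most \<open>d c\<close> of the \<open>m\<close> diagonal shifts of the grid, so the best shift cuts only \<open>O(N / m) = O(s)\<close>
  edges. In the first round all machines exchange, for each shift, the number of their edges it cuts
  and \<open>m\<close> regular samples of their sorted cell keys; as \<open>m\<^sup>3 \<in> O(s)\<close>, everybody can then compute the
  best shift and the same assignment of cells to machines, which gives each machine \<open>O(s)\<close> items. In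
  the second round the items are routed to the owners of their cells, which label the components
  inside their cells. The third round sends the cut edges with the local labels of their ends to
  machine 0, which merges the labels, and the fourth returns the merged labels.\<close>

section \<open>Codes, samples and shifted grids\<close>

text \<open>Averaging over all \<open>m\<close> shifts takes the place of a random shift: some shift
  is at least as good as the average, and the statistics of all shifts together are small enough to
  be exchanged. The harder point is to distribute the cells evenly without randomness, since no
  machine knows how full a cell is. Regular samples of the sorted cell keys split the keys into
  nearly equal intervals, with an error of one block per machine and of the content of one cell;
  this is why a single cell must already fit into a machine. The cube in the memory bound stands for
  receivers times shifts times samples, the \<open>d\<close>-th power for the points of a cell.
  Nodes are coded as single numbers, and a label is the code of a node of the class. So labels made
  by different machines never clash, and machine 0 can merge them without knowing the inside of a
  cell. The price is the size of the codes: it stays polynomial with an exponent independent of the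
  graph because only lists of bounded length are ever coded.\<close>

fun code_exponent :: "nat \<Rightarrow> nat \<Rightarrow> nat" where
  "code_exponent k 0 = k"
| "code_exponent k (Suc n) = 2 * code_exponent k n + 3"

lemma code_exponent_mono: "n \<le> n' \<Longrightarrow> code_exponent k n \<le> code_exponent k n'"
  by (rule lift_Suc_mono_le[of "code_exponent k"]) auto

lemma prod_encode_le:
  assumes "x \<le> M" "y \<le> M"
  shows "prod_encode (x, y) \<le> 2 * M * M + 2 * M"
proof -
  have "triangle (x + y) \<le> ((2 * M) * Suc (2 * M)) div 2"
    unfolding triangle_def using assms by (intro div_le_mono mult_le_mono) auto
  also have "\<dots> = 2 * M * M + M" by (simp add: algebra_simps)
  finally show ?thesis using assms by (simp add: prod_encode_def)
qed

text \<open>With a bound \<open>M\<close> for head and tail, one more element costs at most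
  \<open>2 M^2 + 2 M + 1 <= 5 M^2 <= B^3 M^2\<close>. This is the recursion \<open>2 * n + 3\<close>
  of \<open>code_exponent\<close>; the exponent depends on the length and on \<open>k\<close> but
  not on \<open>B\<close>.\<close>

lemma list_encode_le_power_aux:
  fixes B :: nat
  assumes "2 \<le> B" "\<And>x. x \<in> set xs \<Longrightarrow> x \<le> B ^ k"
  shows "list_encode xs \<le> B ^ code_exponent k (length xs)"
  using assms(2)
proof (induction xs)
  case Nil
  then show ?case by simp
next
  case (Cons x xs)
  define M where "M = B ^ code_exponent k (length xs)"
  have M: "1 \<le> M" using assms(1) by (simp add: M_def)
  have "B ^ k \<le> M" unfolding M_def using assms(1) code_exponent_mono[of 0 "length xs" k]
    by (intro power_increasing) auto
  then have "x \<le> M" using Cons.prems[of x] by simp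
  moreover have "list_encode xs \<le> M" using Cons by (simp add: M_def)
  ultimately have "list_encode (x # xs) \<le> 2 * M * M + 2 * M + 1"
    using prod_encode_le by simp
  also have "\<dots> \<le> 2 * (M * M) + 2 * (M * M) + M * M"
  proof -
    have "M \<le> M * M" "1 \<le> M * M" using M by (simp_all add: Suc_le_eq)
    then show ?thesis unfolding mult.assoc by linarith
  qed
  also have "\<dots> \<le> 2 ^ 3 * (M * M)" by simp
  also have "\<dots> \<le> B ^ 3 * (M * M)" using assms(1) by (intro mult_right_mono power_mono) auto
  also have "\<dots> = B ^ code_exponent k (length (x # xs))"
    by (simp only: M_def power_add mult_2 length_Cons code_exponent.simps ac_simps)
  finally show ?case .
qed

lemma list_encode_le_power:
  fixes B :: nat
  assumes "2 \<le> B" "\<And>x. x \<in> set xs \<Longrightarrow> x \<le> B ^ k" "length xs \<le> n"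
  shows "list_encode xs \<le> B ^ code_exponent k n"
proof -
  have "B ^ code_exponent k (length xs) \<le> B ^ code_exponent k n"
    using assms code_exponent_mono by (intro power_increasing) auto
  with list_encode_le_power_aux[OF assms(1), of xs k] assms(2) show ?thesis by simp
qed

text \<open>Out of range the sample is the junk value 0, which is harmless: additional samples keep the
  upper bound of \<open>sorted_count_le_samples\<close> valid.\<close>

definition sample :: "nat \<Rightarrow> nat list \<Rightarrow> nat \<Rightarrow> nat" where
  "sample q ks t = (if t * q < length ks then ks ! (t * q) else 0)"

section \<open>Counting keys by regular samples\<close>

lemma card_le_div_image:
  assumes "0 < q" "finite X"
  shows "card X \<le> q * card ((\<lambda>x. x div q) ` X)"
proof -
  let ?T = "(\<lambda>x. x div q) ` X"
  have "card X = (\<Sum>t\<in>?T. card {x \<in> X. x div q = t})"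
    using card_eq_sum sum.image_gen[OF assms(2), of "\<lambda>_. 1::nat" "\<lambda>x. x div q"] by auto
  also have "\<dots> \<le> (\<Sum>t\<in>?T. q)"
  proof (rule sum_mono)
    fix t
    have "{x \<in> X. x div q = t} \<subseteq> {t * q..<t * q + q}"
    proof
      fix x assume "x \<in> {x \<in> X. x div q = t}"
      then have "x = t * q + x mod q" by auto
      then show "x \<in> {t * q..<t * q + q}"
        by (metis assms(1) atLeastLessThan_iff le_add1 mod_less_divisor nat_add_left_cancel_less)
    qed
    from card_mono[OF _ this] show "card {x \<in> X. x div q = t} \<le> q" by simp
  qed
  finally show ?thesis by (simp add: mult.commute)
qed

lemma sorted_count_le_samples:
  assumes "sorted ks" "length ks \<le> p * q" "0 < q"
  shows "length (filter (\<lambda>k. a \<le> k \<and> k < b) ks)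
           \<le> q * (card {t. t < p \<and> a \<le> sample q ks t \<and> sample q ks t < b} + 1)"
proof -
  define X where "X = {x. x < length ks \<and> a \<le> ks ! x \<and> ks ! x < b}"
  define T where "T = {t. t < p \<and> a \<le> sample q ks t \<and> sample q ks t < b}"
  have fin: "finite X" "finite T" by (auto simp: X_def T_def)
  \<comment> \<open>Of the blocks of \<open>q\<close> positions that meet the interval \<open>X\<close>, all but the first start inside it,
    and the start of a block is a sample.\<close>
  have "length (filter (\<lambda>k. a \<le> k \<and> k < b) ks) = card X"
    by (simp add: length_filter_conv_card X_def)
  also have "\<dots> \<le> q * card ((\<lambda>x. x div q) ` X)"
    by (rule card_le_div_image) (use assms fin in auto)
  also have "card ((\<lambda>x. x div q) ` X) \<le> card T + 1"
  proof (cases "X = {}")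
    case False
    define x0 where "x0 = Min X"
    have x0: "x0 \<in> X" "\<And>x. x \<in> X \<Longrightarrow> x0 \<le> x"
      using False fin by (auto simp: x0_def)
    have "(\<lambda>x. x div q) ` X \<subseteq> insert (x0 div q) T"
    proof clarify
      fix x assume x: "x \<in> X" "x div q \<notin> T"
      show "x div q = x0 div q"
      proof (rule ccontr)
        assume "x div q \<noteq> x0 div q"
        then have lt: "x0 div q < x div q" using x0(2)[OF x(1)] div_le_mono by (metis le_neq_implies_less)
        define y where "y = x div q * q"
        have "x0 < y"
          using lt assms(3) unfolding y_def by (simp add: div_less_iff_less_mult)
        moreover have "y \<le> x" by (simp add: y_def)
        moreover have "x < length ks" using x by (simp add: X_def)
        ultimately have "ks ! x0 \<le> ks ! y" "ks ! y \<le> ks ! x" "y < length ks"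
          using assms(1) by (auto intro!: sorted_nth_mono)
        moreover have "x div q < p" using \<open>x < length ks\<close> assms
          by (simp add: div_less_iff_less_mult)
        ultimately have "x div q \<in> T"
          using x(1) x0(1) by (auto simp: T_def X_def sample_def y_def)
        with x(2) show False by simp
      qed
    qed
    then have "card ((\<lambda>x. x div q) ` X) \<le> card (insert (x0 div q) T)"
      using fin by (intro card_mono) auto
    also have "\<dots> \<le> card T + 1" using fin by (simp add: card_insert_if)
    finally show ?thesis .
  qed simp
  finally show ?thesis by (simp add: T_def)
qed

section \<open>Shifts separating two points, sizes of cells and neighbourhoods\<close>

lemma card_shifts_separating_le:
  fixes x y m :: nat
  assumes "0 < m" "x \<le> y"
  shows "card {r. r < m \<and> (x + r) div m \<noteq> (y + r) div m} \<le> y - x"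
proof -
  \<comment> \<open>A separating shift puts a multiple of \<open>m\<close> into the interval from
    \<open>x + r\<close> (exclusive) to \<open>y + r\<close> (inclusive), so that \<open>m\<close>
    divides \<open>t + r\<close> for some \<open>t\<close> in \<open>{x<..y}\<close>. Each such
    \<open>t\<close> admits at most one \<open>r < m\<close>.\<close>
  have sub: "{r. r < m \<and> (x + r) div m \<noteq> (y + r) div m}
      \<subseteq> (\<Union>t\<in>{x<..y}. {r. r < m \<and> m dvd t + r})"
  proof clarify
    fix r assume r: "r < m" "(x + r) div m \<noteq> (y + r) div m"
    define k where "k = (y + r) div m"
    have lt: "(x + r) div m < k" using r assms div_le_mono[of "x + r" "y + r" m] by (auto simp: k_def)
    have "x + r < k * m" using lt assms(1) by (simp add: div_less_iff_less_mult)
    moreover have "k * m \<le> y + r" by (simp add: k_def)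
    ultimately show "r \<in> (\<Union>t\<in>{x<..y}. {r. r < m \<and> m dvd t + r})"
      using r(1) by (intro UN_I[of "k * m - r"]) auto
  qed
  have one: "card {r. r < m \<and> m dvd t + r} \<le> 1" for t
  proof -
    have "r' - r = 0" if "r' < m" "m dvd t + r" "m dvd t + r'" for r r'
    proof -
      have "m dvd r' - r" using dvd_diff_nat[OF that(3,2)] by simp
      then show ?thesis using that(1) by (metis dvd_imp_le less_imp_diff_less linorder_not_less not_gr0)
    qed
    then have "r = r'" if "r < m" "r' < m" "m dvd t + r" "m dvd t + r'" for r r'
      using that by (metis diff_is_0_eq le_antisym)
    then show ?thesis by (auto simp: card_le_Suc0_iff_eq)
  qed
  have "card {r. r < m \<and> (x + r) div m \<noteq> (y + r) div m}
     \<le> card (\<Union>t\<in>{x<..y}. {r. r < m \<and> m dvd t + r})"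
    by (rule card_mono[OF _ sub]) auto
  also have "\<dots> \<le> (\<Sum>t\<in>{x<..y}. card {r. r < m \<and> m dvd t + r})"
    by (rule card_UN_le) simp
  also have "\<dots> \<le> (\<Sum>t\<in>{x<..y}. 1)" by (rule sum_mono) (use one in simp)
  finally show ?thesis by simp
qed

text \<open>Union bound: two points lie in different cells only if one of the \<open>d\<close>
  coordinates is separated, and each coordinate is separated by at most \<open>c\<close>
  shifts.\<close>

lemma card_shifts_separating_points_le:
  fixes u v :: point
  assumes "0 < m" "length u = d" "length v = d"
    "\<And>k. k < d \<Longrightarrow> \<bar>int (u ! k) - int (v ! k)\<bar> \<le> int c"
  shows "card {r. r < m \<and> map (\<lambda>x. (x + r) div m) u \<noteq> map (\<lambda>x. (x + r) div m) v} \<le> d * c"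
proof -
  let ?S = "\<lambda>k. {r. r < m \<and> (u ! k + r) div m \<noteq> (v ! k + r) div m}"
  have card_S: "card (?S k) \<le> c" if "k < d" for k
  proof (cases "u ! k \<le> v ! k")
    case True
    then show ?thesis using card_shifts_separating_le[OF assms(1) True] assms(4)[OF that] by linarith
  next
    case False
    have "?S k = {r. r < m \<and> (v ! k + r) div m \<noteq> (u ! k + r) div m}" by auto
    then show ?thesis
      using card_shifts_separating_le[OF assms(1), of "v ! k" "u ! k"] False assms(4)[OF that] by simp
  qed
  have "{r. r < m \<and> map (\<lambda>x. (x + r) div m) u \<noteq> map (\<lambda>x. (x + r) div m) v} \<subseteq> (\<Union>k<d. ?S k)"
    using assms(2,3) by (auto simp: list_eq_iff_nth_eq)
  then have "card {r. r < m \<and> map (\<lambda>x. (x + r) div m) u \<noteq> map (\<lambda>x. (x + r) div m) v} \<le> card (\<Union>k<d. ?S k)"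
    by (intro card_mono) auto
  also have "\<dots> \<le> (\<Sum>k<d. card (?S k))" by (rule card_UN_le) simp
  also have "\<dots> \<le> d * c"
    using sum_bounded_above[of "{..<d}" "\<lambda>k. card (?S k)" c] card_S by simp
  finally show ?thesis .
qed

text \<open>Within a cell the quotients are fixed, so a point is determined by its \<open>d\<close>
  remainders modulo \<open>m\<close>.\<close>

lemma card_cell_le:
  fixes m d r :: nat and key :: "nat list"
  assumes "0 < m"
  defines "S \<equiv> {v :: point. length v = d \<and> map (\<lambda>x. (x + r) div m) v = key}"
  shows "finite S" "card S \<le> m ^ d"
proof -
  let ?f = "map (\<lambda>x. (x + r) mod m)"
  let ?L = "{xs :: nat list. set xs \<subseteq> {..<m} \<and> length xs = d}"
  have inj: "inj_on ?f S"
  proof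
    fix u v assume uv: "u \<in> S" "v \<in> S" "?f u = ?f v"
    show "u = v"
    proof (rule nth_equalityI)
      show "length u = length v" using uv by (simp add: S_def)
      fix k assume k: "k < length u"
      have "(u ! k + r) div m = (v ! k + r) div m"
        using uv k nth_map[of k u "\<lambda>x. (x + r) div m"] nth_map[of k v "\<lambda>x. (x + r) div m"]
        by (simp add: S_def)
      moreover have "(u ! k + r) mod m = (v ! k + r) mod m"
        using uv k nth_map[of k u "\<lambda>x. (x + r) mod m"] nth_map[of k v "\<lambda>x. (x + r) mod m"]
        by (simp add: S_def)
      ultimately have "u ! k + r = v ! k + r" by (metis div_mult_mod_eq)
      then show "u ! k = v ! k" by simp
    qed
  qed
  have sub: "?f ` S \<subseteq> ?L" using assms(1) by (auto simp: S_def)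
  have finL: "finite ?L" by (rule finite_lists_length_eq) simp
  show "finite S" using inj_on_finite[OF inj sub finL] .
  have "card S \<le> card ?L" by (rule card_inj_on_le[OF inj sub finL])
  then show "card S \<le> m ^ d" by (simp add: card_lists_length_eq)
qed

lemma card_neighbours_le:
  fixes u :: point and c :: nat
  assumes "length u = d"
  defines "S \<equiv> {v :: point. length v = d \<and> (\<forall>k<d. \<bar>int (u ! k) - int (v ! k)\<bar> \<le> int c)}"
  shows "finite S" "card S \<le> (2 * c + 1) ^ d"
proof -
  \<comment> \<open>The difference to \<open>u\<close> is moved by \<open>c\<close> into the range
    from 0 to \<open>2 * c\<close>; on \<open>S\<close> the subtraction of natural numbers never
    truncates, which makes the map injective.\<close>
  let ?f = "\<lambda>v. map (\<lambda>k. v ! k + c - u ! k) [0..<d]"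
  let ?L = "{xs :: nat list. set xs \<subseteq> {..<2 * c + 1} \<and> length xs = d}"
  have inj: "inj_on ?f S"
  proof
    fix v w assume vw: "v \<in> S" "w \<in> S" "?f v = ?f w"
    show "v = w"
    proof (rule nth_equalityI)
      show "length v = length w" using vw by (simp add: S_def)
      fix k assume k: "k < length v"
      then have kd: "k < d" using vw by (simp add: S_def)
      have "v ! k + c - u ! k = w ! k + c - u ! k" using vw(3) kd by auto
      moreover have "\<bar>int (u ! k) - int (v ! k)\<bar> \<le> int c" "\<bar>int (u ! k) - int (w ! k)\<bar> \<le> int c"
        using vw(1,2) kd by (auto simp: S_def)
      ultimately show "v ! k = w ! k" by linarith
    qed
  qed
  have sub: "?f ` S \<subseteq> ?L"
  proof clarify
    fix v assume v: "v \<in> S"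
    have "v ! k + c - u ! k < 2 * c + 1" if "k < d" for k
    proof -
      have "\<bar>int (u ! k) - int (v ! k)\<bar> \<le> int c" using v that by (auto simp: S_def)
      then show ?thesis by linarith
    qed
    then show "set (?f v) \<subseteq> {..<2 * c + 1} \<and> length (?f v) = d" by auto
  qed
  have finL: "finite ?L" by (rule finite_lists_length_eq) simp
  show "finite S" using inj_on_finite[OF inj sub finL] .
  have "card S \<le> card ?L" by (rule card_inj_on_le[OF inj sub finL])
  then show "card S \<le> (2 * c + 1) ^ d" by (simp add: card_lists_length_eq)
qed

section \<open>Cell decompositions\<close>

text \<open>The least reachable node represents a class. Being a node, it cannot coincide with the
  representative of another class, and \<open>canon R x <= x\<close> keeps labels within the word
  limit.\<close>

definition canon :: "(nat \<times> nat) set \<Rightarrow> nat \<Rightarrow> nat" where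
  "canon R x = (LEAST y. (x, y) \<in> R\<^sup>*)"

lemma canon_reachable: "(x, canon R x) \<in> R\<^sup>*"
  unfolding canon_def by (rule LeastI[of _ x]) simp

lemma canon_le: "canon R x \<le> x"
  unfolding canon_def by (rule Least_le) simp

lemma canon_eq_iff:
  assumes "sym R"
  shows "canon R x = canon R y \<longleftrightarrow> (x, y) \<in> R\<^sup>*"
proof
  have s: "sym (R\<^sup>*)" using assms by (rule sym_rtrancl)
  show "(x, y) \<in> R\<^sup>*" if "canon R x = canon R y"
    using canon_reachable[of x R] canon_reachable[of y R] symD[OF s] that by (metis rtrancl_trans)
  show "canon R x = canon R y" if "(x, y) \<in> R\<^sup>*"
  proof -
    have "(x, z) \<in> R\<^sup>* \<longleftrightarrow> (y, z) \<in> R\<^sup>*" for z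
      using that symD[OF s that] by (metis rtrancl_trans)
    then show ?thesis by (simp add: canon_def)
  qed
qed

section \<open>Statistics and rounds as operations on sets of words\<close>

definition cut :: "(nat \<Rightarrow> nat \<Rightarrow> nat) \<Rightarrow> (nat \<times> nat) list \<Rightarrow> nat \<Rightarrow> nat" where
  "cut ce ps r = length (filter (\<lambda>(a, b). ce r a \<noteq> ce r b) ps)"

definition cell_keys :: "(nat \<Rightarrow> nat \<Rightarrow> nat) \<Rightarrow> (nat \<times> nat) list \<Rightarrow> nat \<Rightarrow> nat list" where
  "cell_keys ce ps r = sort (map (\<lambda>p. ce r (fst p)) ps @ map (\<lambda>p. ce r (snd p)) ps)"

text \<open>A word of the list stands for a shift \<open>r = x div (m + 1)\<close>: the last of its \<open>m + 1\<close> words is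
  the number of cut items, the others are samples of the cell keys.\<close>

definition stats :: "(nat \<Rightarrow> nat \<Rightarrow> nat) \<Rightarrow> nat \<Rightarrow> nat \<Rightarrow> (nat \<times> nat) list \<Rightarrow> nat list" where
  "stats ce m q ps =
     map (\<lambda>x. let r = x div (m + 1); t = x mod (m + 1) in
            if t = m then cut ce ps r else sample q (cell_keys ce ps r) t) [0..<m * (m + 1)]"

definition best_shift :: "nat \<Rightarrow> (nat \<Rightarrow> nat list) \<Rightarrow> nat" where
  "best_shift m st = arg_min_on (\<lambda>r. \<Sum>i<m. st i ! (r * (m + 1) + m)) {..<m}"

text \<open>The samples below \<open>k\<close>, taken over all machines, are counted in portions of
  \<open>m + 1\<close>. There are \<open>m * m < m * (m + 1)\<close> samples in all, so the quotient
  is a machine number. It is monotone in \<open>k\<close>, so a machine owns an interval of cell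
  keys.\<close>

definition bucket :: "nat \<Rightarrow> (nat \<Rightarrow> nat list) \<Rightarrow> nat \<Rightarrow> nat \<Rightarrow> nat" where
  "bucket m st r k = (\<Sum>i<m. card {t. t < m \<and> st i ! (r * (m + 1) + t) < k}) div (m + 1)"

text \<open>A word to be sent is a list whose head is the destination. The second entry (the first one after
  delivery) tells the kind: 0 and 1 for a link within a cell and between two cells, 2 for a crossing
  link reported to machine 0 together with its sender, 3 for a node kept by its owner with its local
  label, 4 for a global label returned by machine 0. A node is the link \<open>(a, a)\<close>.\<close>

definition route ::
    "(nat \<Rightarrow> nat \<Rightarrow> nat) \<Rightarrow> nat \<Rightarrow> (nat \<Rightarrow> nat list) \<Rightarrow> (nat \<times> nat) list \<Rightarrow> nat list set" where
  "route ce m st ps =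
     (let r = best_shift m st;
          owner = (\<lambda>a. bucket m st r (ce r a));
          flag = (\<lambda>a b. if ce r a = ce r b then 0 else 1)
      in \<Union>(a, b)\<in>set ps. {[owner a, flag a b, a, b], [owner b, flag b a, b, a]})"

text \<open>The receiver owns the cell of \<open>a\<close> only; the label of \<open>b\<close>
  reaches machine 0 with the reversed link, from the owner of \<open>b\<close>. A memory is always
  rebuilt from the inbox, hence the nodes to be kept are sent by a machine to itself.\<close>

definition label_locally :: "nat \<Rightarrow> nat list set \<Rightarrow> nat list set" where
  "label_locally j J =
     (let lab = canon {(a, b). [0, a, b] \<in> J}
      in {[0, 2, j, a, b, lab a] |a b. [1, a, b] \<in> J} \<union> {[j, 3, a, lab a] |a. [0, a, a] \<in> J})"

text \<open>In \<open>H\<close> every end of a crossing link is joined to the far end and to its own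
  local label. The label stands for the whole component inside the cell, whose links machine 0 does
  not see.\<close>

definition merge_labels :: "nat \<Rightarrow> nat list set \<Rightarrow> nat list set" where
  "merge_labels j J =
     (let H = {(a, x). \<exists>i b l. [2, i, a, b, l] \<in> J \<and> (x = b \<or> x = l)}
      in {[i, 4, l, canon (H \<union> H\<inverse>) l] |i a b l. [2, i, a, b, l] \<in> J} \<union>
         {[j, 3, a, l] |a l. [3, a, l] \<in> J})"

text \<open>All answers for one label agree, so the choice is harmless. A label without an answer
  belongs to a component of a cell that no crossing link touches, and is therefore final
  already.\<close>

definition final_labels :: "nat list set \<Rightarrow> nat list set" where
  "final_labels J =
     {[a, if \<exists>f. [4, l, f] \<in> J then SOME f. [4, l, f] \<in> J else l] |a l. [3, a, l] \<in> J}"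

definition delivered :: "nat \<Rightarrow> (nat \<Rightarrow> nat list set) \<Rightarrow> nat \<Rightarrow> nat list set" where
  "delivered m X j = {w. \<exists>i<m. j # w \<in> X i}"

text \<open>\<open>delivered\<close> merges equal words of different senders, whereas the traffic
  has to be charged for each copy.\<close>

definition received :: "nat \<Rightarrow> (nat \<Rightarrow> nat list set) \<Rightarrow> nat \<Rightarrow> nat" where
  "received m X j = (\<Sum>i<m. card {w. j # w \<in> X i})"

lemma same_quotient_add_less:
  fixes n x y :: nat
  assumes "0 < n" "(x + y) div n = x div n"
  shows "y < n"
proof -
  have "x + y = x div n * n + (x + y) mod n"
    using div_mult_mod_eq[of "x + y" n] assms(2) by simp
  moreover have "(x + y) mod n < n" "x div n * n \<le> x" using assms(1) by simp_all
  ultimately show ?thesis by linarith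
qed

text \<open>\<open>pl i\<close> is the input of machine \<open>i\<close>, an edge being coded as a pair and a node \<open>a\<close> as the pair
  \<open>(a, a)\<close>; \<open>ce r a\<close> is the cell of \<open>a\<close> in the grid with shift \<open>r\<close>.\<close>

locale decomposition =
  fixes pl :: "nat \<Rightarrow> (nat \<times> nat) list" and ce :: "nat \<Rightarrow> nat \<Rightarrow> nat" and m q nb M K :: nat
    and P :: "(nat \<times> nat) set"
  defines "P \<equiv> set (concat (map pl [0..<m]))"
  assumes m_pos: "0 < m"
    and dist: "distinct (concat (map pl [0..<m]))"
    and len: "\<And>i. i < m \<Longrightarrow> length (pl i) \<le> nb"
    and q_pos: "0 < q" and q: "2 * nb \<le> m * q"
    and few: "\<And>a b. (a, b) \<in> P \<Longrightarrow> card {r. r < m \<and> ce r a \<noteq> ce r b} \<le> K"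
    and mult1: "\<And>r k. card {p \<in> P. ce r (fst p) = k} \<le> M"
    and mult2: "\<And>r k. card {p \<in> P. ce r (snd p) = k} \<le> M"
begin

section \<open>Statistics and the best shift\<close>

lemma finP: "finite P" by (simp add: P_def)

lemma pl_P: "i < m \<Longrightarrow> p \<in> set (pl i) \<Longrightarrow> p \<in> P" by (auto simp: P_def)

lemma P_E: assumes "p \<in> P" obtains i where "i < m" "p \<in> set (pl i)"
  using assms by (auto simp: P_def)

lemma sum_filter_pl: "(\<Sum>i<m. length (filter \<phi> (pl i))) = card {p \<in> P. \<phi> p}"
proof -
  have "card {p \<in> P. \<phi> p} = length (filter \<phi> (concat (map pl [0..<m])))"
    using distinct_card[OF distinct_filter[OF dist, of \<phi>]] by (simp add: P_def Int_def conj_commute)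
  also have "\<dots> = (\<Sum>i<m. length (filter \<phi> (pl i)))"
    by (simp add: filter_concat length_concat o_def interv_sum_list_conv_sum_set_nat atLeast0LessThan)
  finally show ?thesis by simp
qed

lemma card_filter_pl: "i < m \<Longrightarrow> card {p \<in> set (pl i). \<phi> p} = length (filter \<phi> (pl i))"
proof -
  assume "i < m"
  then have "distinct (pl i)" using dist by (simp add: distinct_concat_iff)
  then show ?thesis using distinct_card[OF distinct_filter] by (metis set_filter)
qed

text \<open>Written as a lookup in an association list because this is literally what the algorithm
  computes from its inbox in the first round.\<close>

definition st where "st = (\<lambda>i. the (map_of (map (\<lambda>i. (i, stats ce m q (pl i))) [0..<m]) i))"

lemma st_eq: "i < m \<Longrightarrow> st i = stats ce m q (pl i)"
  unfolding st_def by (simp add: map_of_map_restrict)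

lemma index_less: "r < m \<Longrightarrow> t \<le> m \<Longrightarrow> r * (m + 1) + t < m * (m + 1)"
proof -
  assume "r < m" "t \<le> m"
  then have "(r + 1) * (m + 1) \<le> m * (m + 1)" by (intro mult_right_mono) auto
  with \<open>t \<le> m\<close> show ?thesis by (simp add: algebra_simps)
qed

lemma st_cut: "i < m \<Longrightarrow> r < m \<Longrightarrow> st i ! (r * (m + 1) + m) = cut ce (pl i) r"
  using index_less[of r m] by (simp add: st_eq stats_def Let_def nth_append del: upt_Suc mult_Suc_right)

lemma st_sample: "i < m \<Longrightarrow> r < m \<Longrightarrow> t < m \<Longrightarrow>
    st i ! (r * (m + 1) + t) = sample q (cell_keys ce (pl i) r) t"
  using index_less[of r t] by (simp add: st_eq stats_def Let_def del: upt_Suc mult_Suc_right)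

definition R where "R = best_shift m st"

lemma R_less: "R < m"
  using arg_min_if_finite(1)[of "{..<m}"] m_pos by (auto simp: R_def best_shift_def lessThan_empty_iff)

definition crossing where "crossing = card {p \<in> P. ce R (fst p) \<noteq> ce R (snd p)}"

text \<open>Double counting of the pairs of a shift and a link cut by it: each link is cut by at
  most \<open>K\<close> shifts, and the best of the \<open>m\<close> shifts cuts at most the
  average.\<close>

lemma crossing_le: "crossing * m \<le> K * card P"
proof -
  let ?f = "\<lambda>r. card {p \<in> P. ce r (fst p) \<noteq> ce r (snd p)}"
  have cut: "(\<Sum>i<m. st i ! (r * (m + 1) + m)) = ?f r" if "r < m" for r
    using that st_cut sum_filter_pl[of "\<lambda>p. ce r (fst p) \<noteq> ce r (snd p)"]
    by (simp add: cut_def case_prod_unfold)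
  have "crossing \<le> ?f r" if "r < m" for r
  proof -
    have "(\<Sum>i<m. st i ! (R * (m + 1) + m)) \<le> (\<Sum>i<m. st i ! (r * (m + 1) + m))"
      unfolding R_def best_shift_def by (rule arg_min_least) (use that in auto)
    then show ?thesis using cut[OF that] cut[OF R_less] by (simp add: crossing_def)
  qed
  then have "crossing * m \<le> (\<Sum>r<m. ?f r)"
    using sum_bounded_below[of "{..<m}" crossing ?f] by (simp add: mult.commute)
  also have "\<dots> = (\<Sum>p\<in>P. card {r \<in> {..<m}. ce r (fst p) \<noteq> ce r (snd p)})"
    using sum.swap_restrict[OF finite_lessThan[of m] finP, of "\<lambda>_ _. 1::nat" "\<lambda>r p. ce r (fst p) \<noteq> ce r (snd p)"]
    by simp
  also have "\<dots> \<le> (\<Sum>p\<in>P. K)"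
    by (rule sum_mono) (use few in auto)
  finally show ?thesis by (simp add: mult.commute)
qed

section \<open>Balanced assignment of cells to machines\<close>

definition owner where "owner a = bucket m st R (ce R a)"

lemma owner_less: "owner a < m"
proof -
  have "card {t. t < m \<and> \<phi> t} \<le> m" for \<phi>
    using card_mono[of "{..<m}" "{t. t < m \<and> \<phi> t}"] by auto
  then have "(\<Sum>i<m. card {t. t < m \<and> st i ! (R * (m + 1) + t) < ce R a}) \<le> m * m"
    using sum_bounded_above[of "{..<m}" "\<lambda>i. card {t. t < m \<and> st i ! (R * (m + 1) + t) < ce R a}" m] by simp
  also have "m * m < m * (m + 1)" using m_pos by simp
  finally show ?thesis unfolding owner_def bucket_def by (simp add: less_mult_imp_div_less)
qed

text \<open>One \<open>m * q\<close> pays for the at most \<open>m\<close> samples that fall between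
  the least and the largest key of a bucket, the other for a rounding error of one block of
  \<open>q\<close> keys on each of the \<open>m\<close> machines. \<open>2 * M\<close> pays for the
  largest key itself, occurring as a first or as a second end.\<close>

definition "load = 2 * m * q + 2 * M"

lemma load_le:
  "(\<Sum>i<m. card {p \<in> set (pl i). owner (fst p) = j} + card {p \<in> set (pl i). owner (snd p) = j}) \<le> load"
proof -
  define KS where "KS = {k \<in> (\<lambda>p. ce R (fst p)) ` P \<union> (\<lambda>p. ce R (snd p)) ` P. bucket m st R k = j}"
  define F where "F = (\<lambda>\<phi>. (\<Sum>i<m. length (filter \<phi> (map (\<lambda>p. ce R (fst p)) (pl i) @ map (\<lambda>p. ce R (snd p)) (pl i)))))"
  have F_eq: "F \<phi> = (\<Sum>i<m. card {p \<in> set (pl i). \<phi> (ce R (fst p))} + card {p \<in> set (pl i). \<phi> (ce R (snd p))})" for \<phi>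
    unfolding F_def by (rule sum.cong) (simp_all add: card_filter_pl o_def filter_map)
  have F_card: "F \<phi> = card {p \<in> P. \<phi> (ce R (fst p))} + card {p \<in> P. \<phi> (ce R (snd p))}" for \<phi>
    unfolding F_def by (simp add: filter_map o_def sum.distrib sum_filter_pl)
  have goal: "(\<Sum>i<m. card {p \<in> set (pl i). owner (fst p) = j} + card {p \<in> set (pl i). owner (snd p) = j})
     = F (\<lambda>k. bucket m st R k = j)"
    by (simp add: F_eq owner_def)
  show ?thesis
  proof (cases "KS = {}")
    case True
    then have none: "{p \<in> P. bucket m st R (ce R (fst p)) = j} = {}" "{p \<in> P. bucket m st R (ce R (snd p)) = j} = {}"
      by (auto simp: KS_def)
    show ?thesis unfolding goal F_card none by simp
  next
    case False
    have finKS: "finite KS" by (simp add: KS_def finP)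
    define lo where "lo = Min KS"
    define hi where "hi = Max KS"
    have lohi: "lo \<in> KS" "hi \<in> KS" "\<And>k. k \<in> KS \<Longrightarrow> lo \<le> k \<and> k \<le> hi"
      using False finKS by (auto simp: lo_def hi_def)
    define S where "S = (\<lambda>i a b. {t. t < m \<and> a \<le> sample q (cell_keys ce (pl i) R) t \<and> sample q (cell_keys ce (pl i) R) t < b})"
    have finS: "finite (S i a b)" for i a b by (simp add: S_def)
    have bk: "bucket m st R k = (\<Sum>i<m. card (S i 0 k)) div (m + 1)" for k
    proof -
      have "{t. t < m \<and> st i ! (R * (m + 1) + t) < k} = S i 0 k" if "i < m" for i
        using st_sample[OF that R_less] by (auto simp: S_def)
      then show ?thesis by (simp add: bucket_def)
    qed
    \<comment> \<open>The keys below the largest key \<open>hi\<close> of the bucket lie between at most \<open>m\<close> samples; \<open>hi\<close> itself may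
      be hit by arbitrarily many samples, but a cell contains few items.\<close>
    have "card (S i 0 hi) = card (S i 0 lo) + card (S i lo hi)" for i
    proof -
      have "S i 0 hi = S i 0 lo \<union> S i lo hi" "S i 0 lo \<inter> S i lo hi = {}"
        using lohi(1) lohi(3)[OF lohi(1)] by (auto simp: S_def)
      then show ?thesis using card_Un_disjoint[OF finS finS] by metis
    qed
    then have split: "(\<Sum>i<m. card (S i 0 hi)) = (\<Sum>i<m. card (S i 0 lo)) + (\<Sum>i<m. card (S i lo hi))"
      by (simp add: sum.distrib)
    have quot: "(\<Sum>i<m. card (S i 0 hi)) div (m + 1) = (\<Sum>i<m. card (S i 0 lo)) div (m + 1)"
      using lohi(1,2) by (simp add: KS_def bk)
    have "(\<Sum>i<m. card (S i lo hi)) < m + 1"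
      by (rule same_quotient_add_less[OF _ quot[unfolded split]]) simp
    then have few_samples: "(\<Sum>i<m. card (S i lo hi)) \<le> m" by linarith
    have "F (\<lambda>k. bucket m st R k = j) \<le> F (\<lambda>k. lo \<le> k \<and> k < hi) + F (\<lambda>k. k = hi)"
    proof -
      have "{p \<in> P. bucket m st R (ce R (fst p)) = j} \<subseteq>
          {p \<in> P. lo \<le> ce R (fst p) \<and> ce R (fst p) < hi} \<union> {p \<in> P. ce R (fst p) = hi}"
        using lohi(3) by (fastforce simp: KS_def)
      then have 1: "card {p \<in> P. bucket m st R (ce R (fst p)) = j} \<le>
          card {p \<in> P. lo \<le> ce R (fst p) \<and> ce R (fst p) < hi} + card {p \<in> P. ce R (fst p) = hi}"
        by (rule order_trans[OF card_mono card_Un_le, rotated]) (simp add: finP)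
      have "{p \<in> P. bucket m st R (ce R (snd p)) = j} \<subseteq>
          {p \<in> P. lo \<le> ce R (snd p) \<and> ce R (snd p) < hi} \<union> {p \<in> P. ce R (snd p) = hi}"
        using lohi(3) by (fastforce simp: KS_def)
      then have 2: "card {p \<in> P. bucket m st R (ce R (snd p)) = j} \<le>
          card {p \<in> P. lo \<le> ce R (snd p) \<and> ce R (snd p) < hi} + card {p \<in> P. ce R (snd p) = hi}"
        by (rule order_trans[OF card_mono card_Un_le, rotated]) (simp add: finP)
      show ?thesis using 1 2 by (simp add: F_card)
    qed
    also have "F (\<lambda>k. k = hi) \<le> 2 * M"
      using mult1[of R hi] mult2[of R hi] by (simp add: F_card)
    also have "F (\<lambda>k. lo \<le> k \<and> k < hi) \<le> (\<Sum>i<m. q * (card (S i lo hi) + 1))"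
      unfolding F_def
    proof (rule sum_mono)
      fix i assume "i \<in> {..<m}"
      then have i: "i < m" by simp
      have "length (filter (\<lambda>k. lo \<le> k \<and> k < hi) (map (\<lambda>p. ce R (fst p)) (pl i) @ map (\<lambda>p. ce R (snd p)) (pl i)))
         = length (filter (\<lambda>k. lo \<le> k \<and> k < hi) (cell_keys ce (pl i) R))"
        by (simp only: cell_keys_def filter_sort length_sort)
      \<comment> \<open>A machine has two keys per item, hence at most
        \<open>2 * nb <= m * q\<close> keys, so that \<open>m\<close> samples at distance
        \<open>q\<close> cover the sorted list.\<close>
      also have "\<dots> \<le> q * (card (S i lo hi) + 1)"
        unfolding S_def
        by (rule sorted_count_le_samples) (use len[OF i] q q_pos in \<open>auto simp: cell_keys_def\<close>)
      finally show "length (filter (\<lambda>k. lo \<le> k \<and> k < hi) (map (\<lambda>p. ce R (fst p)) (pl i) @ map (\<lambda>p. ce R (snd p)) (pl i)))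
         \<le> q * (card (S i lo hi) + 1)" .
    qed
    also have "\<dots> = q * ((\<Sum>i<m. card (S i lo hi)) + m)"
      by (simp only: sum_distrib_left[symmetric] sum.distrib) simp
    also have "\<dots> \<le> q * (m + m)" using few_samples by simp
    finally show ?thesis unfolding goal load_def by (simp add: algebra_simps)
  qed
qed

text \<open>Links in both orientations (\<open>S\<close>), those within a cell (\<open>F\<close>) and between cells (\<open>X\<close>); \<open>H\<close> is the
  graph that machine 0 sees.\<close>

definition "S = P \<union> P\<inverse>"
definition "F = {(a, b) \<in> S. ce R a = ce R b}"
definition "X = {(a, b) \<in> S. ce R a \<noteq> ce R b}"
definition "lab = canon F"
definition "H = {(a, x). \<exists>b. (a, b) \<in> X \<and> (x = b \<or> x = lab a)}"
definition "fin = canon (H \<union> H\<inverse>)"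
definition "flag a b = (if ce R a = ce R b then 0 else 1 :: nat)"

section \<open>Correctness of the two-level labelling\<close>

lemma S_sym: "(a, b) \<in> S \<longleftrightarrow> (b, a) \<in> S" by (auto simp: S_def)

lemma finS: "finite S" by (simp add: S_def finP)

lemma sym_F: "sym F" and sym_X: "sym X" and sym_S: "sym S"
  by (auto simp: sym_def F_def X_def S_sym)

lemma finX: "finite X" using finS by (rule rev_finite_subset) (auto simp: X_def)

lemma card_X: "card X \<le> 2 * crossing"
proof -
  let ?Y = "{p \<in> P. ce R (fst p) \<noteq> ce R (snd p)}"
  have "X = ?Y \<union> ?Y\<inverse>" by (auto simp: X_def S_def)
  then show ?thesis using card_Un_le[of ?Y "?Y\<inverse>"] by (simp add: crossing_def card_inverse)
qed

lemma F_rtrancl_same_cell: "(a, b) \<in> F\<^sup>* \<Longrightarrow> ce R a = ce R b"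
  by (induction rule: rtrancl_induct) (auto simp: F_def)

lemma owner_cong: "ce R a = ce R b \<Longrightarrow> owner a = owner b"
  by (simp add: owner_def)

lemma lab_eq_iff: "lab a = lab b \<longleftrightarrow> (a, b) \<in> F\<^sup>*"
  unfolding lab_def by (rule canon_eq_iff[OF sym_F])

text \<open>Every link of \<open>H\<close> is a path in \<open>S\<close>, as a label is reachable
  from its node. Conversely, a step of \<open>S\<close> inside a cell does not change the label, and
  for a crossing step \<open>H\<close> contains the path from \<open>lab x\<close> through
  \<open>x\<close> and \<open>y\<close> to \<open>lab y\<close>, up to orientation.\<close>

lemma fin_lab_eq_iff: "fin (lab a) = fin (lab b) \<longleftrightarrow> (a, b) \<in> S\<^sup>*"
proof -
  have fin: "fin x = fin y \<longleftrightarrow> (x, y) \<in> (H \<union> H\<inverse>)\<^sup>*" for x y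
    unfolding fin_def by (rule canon_eq_iff) (auto simp: sym_def)
  have symS: "(x, y) \<in> S\<^sup>* \<Longrightarrow> (y, x) \<in> S\<^sup>*" for x y
    using sym_rtrancl[OF sym_S] by (auto dest: symD)
  have labS: "(x, lab x) \<in> S\<^sup>*" for x
    using canon_reachable[of x F] rtrancl_mono[of F S] by (auto simp: lab_def F_def)
  have HS: "H \<subseteq> S\<^sup>*" using labS by (auto simp: H_def X_def)
  then have "(H \<union> H\<inverse>)\<^sup>* \<subseteq> S\<^sup>*" using symS by (intro rtrancl_subset_rtrancl) auto
  moreover have step: "fin (lab x) = fin (lab y)" if "(x, y) \<in> S" for x y
  proof (cases "(x, y) \<in> F")
    case True
    then have "lab x = lab y" by (auto simp: lab_eq_iff)
    then show ?thesis by simp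
  next
    case False
    with that have "(x, y) \<in> X" "(y, x) \<in> X" using sym_X by (auto simp: F_def X_def S_sym)
    then have "(x, y) \<in> H" "(x, lab x) \<in> H" "(y, lab y) \<in> H" by (auto simp: H_def)
    then have "fin x = fin y" "fin x = fin (lab x)" "fin y = fin (lab y)" by (auto simp: fin)
    then show ?thesis by simp
  qed
  have "fin (lab a) = fin (lab b)" if "(a, b) \<in> S\<^sup>*"
    using that by (induction rule: rtrancl_induct) (auto dest: step)
  ultimately show ?thesis using labS symS by (meson fin rtrancl_trans subsetD)
qed

text \<open>\<open>Xt i\<close> is what machine \<open>i\<close> holds after round \<open>t\<close>, and \<open>Jt i\<close> what it receives in round \<open>t + 1\<close>.\<close>

definition "X1 i = route ce m st (pl i)"
definition "J1 = delivered m X1"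
definition "X2 i = label_locally i (J1 i)"
definition "J2 = delivered m X2"
definition "X3 i = merge_labels i (J2 i)"
definition "J3 = delivered m X3"
definition "X4 i = final_labels (J3 i)"

section \<open>Memories and inboxes of the single rounds\<close>

lemma X1_eq: "X1 i = (\<Union>(a, b)\<in>set (pl i). {[owner a, flag a b, a, b], [owner b, flag b a, b, a]})"
  by (simp add: X1_def route_def Let_def R_def[symmetric] owner_def flag_def)

text \<open>Since a link is sent in both orientations, the owner of each end receives it with that
  end first. So an owner sees every link at the nodes of its cells.\<close>

lemma J1_eq: "J1 j = {[flag a b, a, b] |a b. (a, b) \<in> S \<and> owner a = j}"
proof (intro equalityI subsetI)
  fix w assume "w \<in> J1 j"
  then show "w \<in> {[flag a b, a, b] |a b. (a, b) \<in> S \<and> owner a = j}"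
    by (fastforce simp: J1_def delivered_def X1_eq S_def dest: pl_P)
next
  fix w assume "w \<in> {[flag a b, a, b] |a b. (a, b) \<in> S \<and> owner a = j}"
  then obtain a b where w: "w = [flag a b, a, b]" "(a, b) \<in> S" "owner a = j" by auto
  from w(2) have "(a, b) \<in> P \<or> (b, a) \<in> P" by (auto simp: S_def)
  then obtain i where "i < m" "(a, b) \<in> set (pl i) \<or> (b, a) \<in> set (pl i)" by (metis P_E)
  then show "w \<in> J1 j" using w by (fastforce simp: J1_def delivered_def X1_eq)
qed

lemma J1_flag: "[0, a, b] \<in> J1 j \<longleftrightarrow> (a, b) \<in> F \<and> owner a = j"
  "[1, a, b] \<in> J1 j \<longleftrightarrow> (a, b) \<in> X \<and> owner a = j"
  by (auto simp: J1_eq F_def X_def flag_def)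

text \<open>A path in \<open>F\<close> never leaves the cell of \<open>a\<close>, and a cell has a
  single owner, so all links of the path have been delivered to \<open>j\<close>.\<close>

lemma local_canon:
  assumes "owner a = j"
  shows "canon {(a, b). [0, a, b] \<in> J1 j} a = lab a"
proof -
  let ?G = "{(a, b). [0, a, b] \<in> J1 j}"
  have "(a, x) \<in> ?G\<^sup>* \<longleftrightarrow> (a, x) \<in> F\<^sup>*" for x
  proof
    show "(a, x) \<in> F\<^sup>*" if "(a, x) \<in> ?G\<^sup>*"
      using that rtrancl_mono[of ?G F] by (auto simp: J1_flag)
    show "(a, x) \<in> ?G\<^sup>*" if "(a, x) \<in> F\<^sup>*"
      using that
    proof (induction rule: rtrancl_induct)
      case (step y z)
      then have "owner y = j" using F_rtrancl_same_cell owner_cong assms by metis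
      then have "(y, z) \<in> ?G" using step by (simp add: J1_flag)
      with step show ?case by (meson rtrancl.rtrancl_into_rtrancl)
    qed simp
  qed
  then show ?thesis by (simp add: lab_def canon_def)
qed

lemma P_loop: "(a, a) \<in> S \<longleftrightarrow> (a, a) \<in> P" by (auto simp: S_def)

definition "own j = {[3, a, lab a] |a. (a, a) \<in> P \<and> owner a = j}"

lemma X2_eq: "X2 j = {[0, 2, j, a, b, lab a] |a b. (a, b) \<in> X \<and> owner a = j} \<union> (\<lambda>w. j # w) ` own j"
proof -
  define G where "G = canon {(a, b). [0, a, b] \<in> J1 j}"
  have G: "owner a = j \<Longrightarrow> G a = lab a" for a by (simp add: G_def local_canon)
  have "X2 j = {[0, 2, j, a, b, G a] |a b. (a, b) \<in> X \<and> owner a = j} \<union>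
     {[j, 3, a, G a] |a. (a, a) \<in> F \<and> owner a = j}"
    unfolding X2_def label_locally_def Let_def J1_flag G_def by simp
  also have "\<dots> = {[0, 2, j, a, b, lab a] |a b. (a, b) \<in> X \<and> owner a = j} \<union>
     {[j, 3, a, lab a] |a. (a, a) \<in> F \<and> owner a = j}"
    using G by auto
  also have "{[j, 3, a, lab a] |a. (a, a) \<in> F \<and> owner a = j} = (\<lambda>w. j # w) ` own j"
    by (auto simp: own_def F_def P_loop)
  finally show ?thesis .
qed

definition "cross_words = {[2, owner a, a, b, lab a] |a b. (a, b) \<in> X}"

lemma J2_eq: "j < m \<Longrightarrow> J2 j = (if j = 0 then cross_words else {}) \<union> own j"
  using m_pos owner_less by (auto simp: J2_def delivered_def X2_eq cross_words_def)

lemma X3_eq: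
  assumes "j < m"
  shows "X3 j = (if j = 0 then {[owner a, 4, lab a, fin (lab a)] |a b. (a, b) \<in> X} else {})
           \<union> (\<lambda>w. j # w) ` own j"
proof -
  have two: "[2, i, a, b, l] \<in> J2 j \<longleftrightarrow> j = 0 \<and> i = owner a \<and> l = lab a \<and> (a, b) \<in> X" for i a b l
    using assms by (auto simp: J2_eq cross_words_def own_def)
  have three: "[3, a, l] \<in> J2 j \<longleftrightarrow> [3, a, l] \<in> own j" for a l
    using assms by (auto simp: J2_eq cross_words_def own_def)
  have "{[j, 3, a, l] |a l. [3, a, l] \<in> own j} = (\<lambda>w. j # w) ` own j" by (auto simp: own_def)
  moreover have "{(a, x). \<exists>i b l. (j = 0 \<and> i = owner a \<and> l = lab a \<and> (a, b) \<in> X) \<and> (x = b \<or> x = l)} = H"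
    if "j = 0"
    using that by (auto simp: H_def)
  ultimately show ?thesis
    unfolding X3_def merge_labels_def Let_def three two
    by (cases "j = 0") (auto simp: fin_def)
qed

lemma J3_eq:
  assumes "j < m"
  shows "J3 j = {[4, lab a, fin (lab a)] |a b. (a, b) \<in> X \<and> owner a = j} \<union> own j"
proof -
  have "j # w \<in> X3 i \<longleftrightarrow>
      i = 0 \<and> (\<exists>a b. (a, b) \<in> X \<and> owner a = j \<and> w = [4, lab a, fin (lab a)]) \<or> i = j \<and> w \<in> own j"
    if "i < m" for i w
    by (auto simp: X3_eq[OF that])
  then have "w \<in> J3 j \<longleftrightarrow>
      (\<exists>a b. (a, b) \<in> X \<and> owner a = j \<and> w = [4, lab a, fin (lab a)]) \<or> w \<in> own j" for w
    unfolding J3_def delivered_def mem_Collect_eq using m_pos assms by metis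
  then show ?thesis by blast
qed

text \<open>Machine 0 answers for labels of first ends of crossing links only. As \<open>X\<close>
  is symmetric and a label lies in the class of its node, every class that meets \<open>H\<close>
  contains such an end, and it has the same owner; hence no answer that is needed is
  missing.\<close>

lemma H_vertex_class:
  assumes "x \<in> Field H"
  shows "\<exists>a b. (a, b) \<in> X \<and> lab a = lab x \<and> owner a = owner x"
proof -
  have "\<exists>a b. (a, b) \<in> X \<and> (a, x) \<in> F\<^sup>*"
  proof -
    from assms obtain a b where "(a, b) \<in> X" "x = a \<or> x = b \<or> x = lab a"
      by (auto simp: Field_def H_def)
    moreover have "(b, a) \<in> X" using calculation sym_X by (auto dest: symD)
    ultimately show ?thesis using canon_reachable[of a F] by (auto simp: lab_def)
  qed
  then show ?thesis using lab_eq_iff F_rtrancl_same_cell owner_cong by blast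
qed

lemma fin_isolated: "x \<notin> Field H \<Longrightarrow> fin x = x"
proof -
  assume x: "x \<notin> Field H"
  have "(x, fin x) \<in> (H \<union> H\<inverse>)\<^sup>*" unfolding fin_def by (rule canon_reachable)
  then show ?thesis using x by (cases rule: converse_rtranclE) (auto simp: Field_def)
qed

lemma X4_eq:
  assumes "j < m"
  shows "X4 j = {[a, fin (lab a)] |a. (a, a) \<in> P \<and> owner a = j}"
proof -
  have four: "[4, l, f] \<in> J3 j \<longleftrightarrow> (\<exists>a b. (a, b) \<in> X \<and> owner a = j \<and> l = lab a \<and> f = fin (lab a))" for l f
    using assms by (auto simp: J3_eq own_def)
  have three: "[3, a, l] \<in> J3 j \<longleftrightarrow> (a, a) \<in> P \<and> owner a = j \<and> l = lab a" for a l
    using assms by (auto simp: J3_eq own_def)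
  define g where "g l = (if \<exists>f. [4, l, f] \<in> J3 j then SOME f. [4, l, f] \<in> J3 j else l)" for l
  have g: "g (lab a) = fin (lab a)" if "owner a = j" for a
  proof (cases "\<exists>f. [4, lab a, f] \<in> J3 j")
    case True
    then have "(SOME f. [4, lab a, f] \<in> J3 j) = fin (lab a)"
      by (rule someI2_ex) (auto simp: four)
    with True show ?thesis by (simp add: g_def)
  next
    case False
    \<comment> \<open>Without an answer the label occurs in no link of \<open>H\<close>, where
      \<open>fin\<close> is the identity; so the default value is the right one.\<close>
    have "lab a \<notin> Field H"
    proof
      have F: "(a, lab a) \<in> F\<^sup>*" unfolding lab_def by (rule canon_reachable)
      then have eq: "lab (lab a) = lab a" "owner (lab a) = owner a"
        using lab_eq_iff F_rtrancl_same_cell owner_cong by metis+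
      assume "lab a \<in> Field H"
      from H_vertex_class[OF this] eq that have "\<exists>a' b'. (a', b') \<in> X \<and> owner a' = j \<and> lab a = lab a'"
        by metis
      with False show False unfolding four by metis
    qed
    with False show ?thesis by (simp add: fin_isolated g_def)
  qed
  have "X4 j = {[a, g l] |a l. [3, a, l] \<in> J3 j}"
    by (simp add: X4_def final_labels_def g_def)
  then show ?thesis using g by (auto simp: three)
qed

section \<open>Numbers of words stored, sent and received\<close>

lemma card_sent_X1:
  assumes "i < m"
  shows "card {w. j # w \<in> X1 i} \<le>
    card {p \<in> set (pl i). owner (fst p) = j} + card {p \<in> set (pl i). owner (snd p) = j}"
proof -
  have "{w. j # w \<in> X1 i} \<subseteq>
     (\<lambda>(a, b). [flag a b, a, b]) ` {p \<in> set (pl i). owner (fst p) = j} \<union>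
     (\<lambda>(a, b). [flag b a, b, a]) ` {p \<in> set (pl i). owner (snd p) = j}"
    by (force simp: X1_eq)
  then have "card {w. j # w \<in> X1 i} \<le> card ((\<lambda>(a, b). [flag a b, a, b]) ` {p \<in> set (pl i). owner (fst p) = j} \<union>
     (\<lambda>(a, b). [flag b a, b, a]) ` {p \<in> set (pl i). owner (snd p) = j})"
    by (intro card_mono) auto
  also have "\<dots> \<le> card {p \<in> set (pl i). owner (fst p) = j} + card {p \<in> set (pl i). owner (snd p) = j}"
    by (intro order_trans[OF card_Un_le] add_mono card_image_le) auto
  finally show ?thesis .
qed

lemma received_X1: "received m X1 j \<le> load"
  unfolding received_def
  by (rule order_trans[OF sum_mono load_le[of j]]) (use card_sent_X1 in auto)

lemma finite_X1: "finite (X1 i)" by (auto simp: X1_eq)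

lemma card_X1: "i < m \<Longrightarrow> card (X1 i) \<le> 2 * nb"
proof -
  assume i: "i < m"
  have "X1 i = (\<lambda>(a, b). [owner a, flag a b, a, b]) ` set (pl i) \<union> (\<lambda>(a, b). [owner b, flag b a, b, a]) ` set (pl i)"
    by (auto simp: X1_eq)
  then have "card (X1 i) \<le> card (set (pl i)) + card (set (pl i))"
    by (auto intro!: order_trans[OF card_Un_le] add_mono card_image_le)
  then show ?thesis using len[OF i] card_length[of "pl i"] by linarith
qed

lemma finite_own: "finite (own j)"
proof -
  have "own j \<subseteq> (\<lambda>p. [3, fst p, lab (fst p)]) ` P" by (force simp: own_def)
  then show ?thesis by (rule finite_subset) (simp add: finP)
qed

lemma card_own: "card (own j) \<le> load"
proof -
  have "card {p \<in> P. owner (fst p) = j} \<le> load"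
  proof -
    have "card {p \<in> P. owner (fst p) = j} = (\<Sum>i<m. card {p \<in> set (pl i). owner (fst p) = j})"
      using sum_filter_pl[of "\<lambda>p. owner (fst p) = j"] by (simp add: card_filter_pl)
    also have "\<dots> \<le> (\<Sum>i<m. card {p \<in> set (pl i). owner (fst p) = j} + card {p \<in> set (pl i). owner (snd p) = j})"
      by (rule sum_mono) simp
    finally show ?thesis using load_le[of j] by linarith
  qed
  moreover have "own j \<subseteq> (\<lambda>p. [3, fst p, lab (fst p)]) ` {p \<in> P. owner (fst p) = j}"
    by (force simp: own_def)
  then have "card (own j) \<le> card {p \<in> P. owner (fst p) = j}"
    by (rule surj_card_le[rotated]) (simp add: finP)
  ultimately show ?thesis by linarith
qed

lemma finite_crossing_words: "finite {f a b |a b. (a, b) \<in> X \<and> \<phi> a}"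
  and card_crossing_words: "card {f a b |a b. (a, b) \<in> X \<and> \<phi> a} \<le> card {p \<in> X. \<phi> (fst p)}"
proof -
  have "{f a b |a b. (a, b) \<in> X \<and> \<phi> a} = (\<lambda>p. f (fst p) (snd p)) ` {p \<in> X. \<phi> (fst p)}" by force
  then show "finite {f a b |a b. (a, b) \<in> X \<and> \<phi> a}"
    and "card {f a b |a b. (a, b) \<in> X \<and> \<phi> a} \<le> card {p \<in> X. \<phi> (fst p)}"
    using finX by (auto intro: card_image_le)
qed

lemma card_crossing_words': "card {f a b |a b. (a, b) \<in> X \<and> \<phi> a} \<le> 2 * crossing"
  by (rule order_trans[OF card_crossing_words order_trans[OF card_mono card_X]]) (auto simp: finX)

lemma finite_crossing_sources: "finite {f a |a. \<exists>b. (a, b) \<in> X}"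
  and card_crossing_sources: "card {f a |a. \<exists>b. (a, b) \<in> X} \<le> 2 * crossing"
  using finite_crossing_words[of "\<lambda>a b. f a" "\<lambda>_. True"]
    card_crossing_words'[of "\<lambda>a b. f a" "\<lambda>_. True"] by simp_all

lemma finite_X2: "finite (X2 j)"
  unfolding X2_eq using finite_own finite_crossing_words by auto

lemma card_X2: "card (X2 j) \<le> 2 * crossing + load"
  unfolding X2_eq
  by (intro order_trans[OF card_Un_le] add_mono card_crossing_words' order_trans[OF card_image_le card_own] finite_own)

lemma finite_X3: "j < m \<Longrightarrow> finite (X3 j)"
  unfolding X3_eq using finite_own finite_crossing_sources by auto

lemma card_X3: "j < m \<Longrightarrow> card (X3 j) \<le> 2 * crossing + load"
  unfolding X3_eq
  using card_crossing_sources
  by (intro order_trans[OF card_Un_le] add_mono order_trans[OF card_image_le card_own] finite_own) auto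

lemma X4_image: "j < m \<Longrightarrow> X4 j = (\<lambda>w. [w ! 1, fin (w ! 2)]) ` own j"
  by (force simp: X4_eq own_def)

lemma finite_X4: "j < m \<Longrightarrow> finite (X4 j)"
  using finite_own by (simp add: X4_image)

lemma card_X4: "j < m \<Longrightarrow> card (X4 j) \<le> load"
  using order_trans[OF card_image_le[OF finite_own] card_own] by (simp add: X4_image)

text \<open>An oriented crossing link is reported only by the owner of its first end, so the reports
  of all senders sum up to \<open>card X\<close>; kept nodes arrive only from the machine
  itself.\<close>

lemma received_X2: assumes "j < m" shows "received m X2 j \<le> 2 * crossing + load"
proof -
  have "card {w. j # w \<in> X2 i} \<le> card {p \<in> X. owner (fst p) = i} + (if i = j then load else 0)" for i
  proof -
    have "{w. j # w \<in> X2 i} \<subseteq> {[2, i, a, b, lab a] |a b. (a, b) \<in> X \<and> owner a = i} \<union> (if i = j then own j else {})"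
      by (auto simp: X2_eq)
    then have "card {w. j # w \<in> X2 i} \<le> card ({[2, i, a, b, lab a] |a b. (a, b) \<in> X \<and> owner a = i} \<union> (if i = j then own j else {}))"
      by (intro card_mono) (auto simp: finite_own finite_crossing_words)
    also have "\<dots> \<le> card {p \<in> X. owner (fst p) = i} + (if i = j then load else 0)"
      by (rule order_trans[OF card_Un_le add_mono[OF card_crossing_words]]) (auto simp: card_own)
    finally show ?thesis .
  qed
  then have "received m X2 j \<le> (\<Sum>i<m. card {p \<in> X. owner (fst p) = i} + (if i = j then load else 0))"
    unfolding received_def by (rule sum_mono)
  also have "\<dots> = (\<Sum>i<m. card {p \<in> X. owner (fst p) = i}) + load"
    using assms by (simp add: sum.distrib)
  also have "(\<Sum>i<m. card {p \<in> X. owner (fst p) = i}) = card X"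
    using sum.group[OF finX finite_lessThan[of m], of "\<lambda>p. owner (fst p)" "\<lambda>_. 1::nat"] owner_less
    by auto
  finally show ?thesis using card_X by linarith
qed

lemma received_X3: assumes "j < m" shows "received m X3 j \<le> 2 * crossing + load"
proof -
  have "card {w. j # w \<in> X3 i} \<le> (if i = 0 then 2 * crossing else 0) + (if i = j then load else 0)" if "i < m" for i
  proof -
    have "{w. j # w \<in> X3 i} \<subseteq> (if i = 0 then {[4, lab a, fin (lab a)] |a. \<exists>b. (a, b) \<in> X} else {}) \<union> (if i = j then own j else {})"
      by (auto simp: X3_eq[OF that])
    then have "card {w. j # w \<in> X3 i} \<le> card ((if i = 0 then {[4, lab a, fin (lab a)] |a. \<exists>b. (a, b) \<in> X} else {}) \<union> (if i = j then own j else {}))"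
      using finite_crossing_sources by (intro card_mono) (auto simp: finite_own)
    also have "\<dots> \<le> (if i = 0 then 2 * crossing else 0) + (if i = j then load else 0)"
      using card_crossing_sources by (intro order_trans[OF card_Un_le] add_mono) (auto simp: card_own)
    finally show ?thesis .
  qed
  then have "received m X3 j \<le> (\<Sum>i<m. (if i = 0 then 2 * crossing else 0) + (if i = j then load else 0))"
    unfolding received_def by (intro sum_mono) auto
  then show ?thesis using assms m_pos by (simp add: sum.distrib)
qed

text \<open>Labels never exceed the node codes they are made from, by \<open>canon_le\<close>;
  \<open>m\<close> accounts for machine numbers and \<open>4\<close> for the kinds.\<close>

lemma entries_le:
  assumes "\<And>a b. (a, b) \<in> P \<Longrightarrow> a \<le> W \<and> b \<le> W" "m \<le> W" "4 \<le> W" "i < m"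
    and "w \<in> X1 i \<union> X2 i \<union> X3 i \<union> X4 i" "x \<in> set w"
  shows "x \<le> W"
proof -
  have S: "a \<le> W" "b \<le> W" if "(a, b) \<in> S" for a b using that assms(1) by (auto simp: S_def)
  have lab: "lab a \<le> W" if "a \<le> W" for a using canon_le[of F a] that by (simp add: lab_def)
  have fin: "fin a \<le> W" if "a \<le> W" for a using canon_le[of "H \<union> H\<inverse>" a] that by (simp add: fin_def)
  have own: "owner a \<le> W" for a using owner_less[of a] assms(2) by simp
  consider "w \<in> X1 i" | "w \<in> X2 i" | "w \<in> X3 i" | "w \<in> X4 i" using assms(5) by auto
  then show ?thesis
  proof cases
    case 1
    then obtain a b where "(a, b) \<in> P" "w = [owner a, flag a b, a, b] \<or> w = [owner b, flag b a, b, a]"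
      using pl_P[OF assms(4)] by (auto simp: X1_eq)
    then show ?thesis using assms(1)[of a b] own assms(3,6) by (auto simp: flag_def)
  next
    case 2
    then show ?thesis using assms(2-6) S lab
      by (auto simp: X2_eq own_def X_def dest: pl_P simp flip: P_loop)
  next
    case 3
    then show ?thesis using assms(2-6) S lab own fin
      by (auto simp: X3_eq own_def X_def simp flip: P_loop split: if_splits)
  next
    case 4
    then show ?thesis using assms(2-6) S lab fin
      by (auto simp: X4_eq simp flip: P_loop)
  qed
qed

lemma dest_less:
  assumes "i < m" "w \<in> X1 i \<union> X2 i \<union> X3 i"
  shows "w \<noteq> []" "hd w < m"
  using assms owner_less by (auto simp: m_pos X1_eq X2_eq X3_eq split: if_splits)

text \<open>The longest word is the report \<open>[0, 2, j, a, b, lab a]\<close> of a crossing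
  link.\<close>

lemma length_words:
  assumes "i < m" "w \<in> X1 i \<union> X2 i \<union> X3 i \<union> X4 i"
  shows "length w \<le> 6"
  using assms by (auto simp: X1_eq X2_eq X3_eq X4_eq own_def split: if_splits)

end

section \<open>The algorithm\<close>

fun ends :: "item \<Rightarrow> point \<times> point" where
  "ends (Node v) = (v, v)"
| "ends (Edge u v) = (u, v)"

fun parse_items :: "nat \<Rightarrow> nat list \<Rightarrow> (point \<times> point) list" where
  "parse_items d [] = []"
| "parse_items d (t # xs) =
     (if t = 0 then (take d xs, take d xs) # parse_items d (drop d xs)
      else (take d xs, take d (drop d xs)) # parse_items d (drop (d + d) xs))"

lemma parse_items_item_words:
  assumes "\<And>it. it \<in> set its \<Longrightarrow> length (fst (ends it)) = d \<and> length (snd (ends it)) = d"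
  shows "parse_items d (concat (map item_words its)) = map ends its"
  using assms
proof (induction its)
  case (Cons it its)
  have "parse_items d (concat (map item_words its)) = map ends its" using Cons by auto
  moreover have "length (fst (ends it)) = d \<and> length (snd (ends it)) = d" using Cons.prems by auto
  ultimately show ?case by (cases it) auto
qed simp

lemma length_item_words: "length (item_words it) \<le> 1 + length (fst (ends it)) + length (snd (ends it))"
  by (cases it) auto

lemma set_item_words: "set (item_words it) \<subseteq> {0, 1} \<union> set (fst (ends it)) \<union> set (snd (ends it))"
  by (cases it) auto

definition coded_items :: "nat \<Rightarrow> nat list \<Rightarrow> (nat \<times> nat) list" where
  "coded_items d mem = map (map_prod list_encode list_encode) (parse_items d mem)"

definition cell_code :: "nat \<Rightarrow> nat \<Rightarrow> nat \<Rightarrow> nat" where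
  "cell_code m r a = list_encode (map (\<lambda>x. (x + r) div m) (list_decode a))"

definition share :: "real \<Rightarrow> nat \<Rightarrow> nat" where
  "share \<alpha> N = nat \<lceil>real N / real (num_machines \<alpha> N)\<rceil>"

text \<open>The summand 1 makes the step positive and compensates for the rounded division, so that
  \<open>num_machines\<close> steps reach across \<open>2 * share\<close> keys.\<close>

definition sample_step :: "real \<Rightarrow> nat \<Rightarrow> nat" where
  "sample_step \<alpha> N = 2 * share \<alpha> N div num_machines \<alpha> N + 1"

definition word_list :: "nat list set \<Rightarrow> nat list list" where
  "word_list X = map list_decode (sorted_list_of_set (list_encode ` X))"

text \<open>The head of a packed memory is a phase number from 2 to 5. The initial memory is recognised by
  its head, which is the tag 0 or 1 of an item.\<close>

definition pack :: "nat \<Rightarrow> nat list set \<Rightarrow> nat list" where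
  "pack t X = t # map list_encode (word_list X)"

text \<open>The rest of a word is coded again as a single number, so a message costs two words
  whatever it says.\<close>

definition outgoing :: "nat list \<Rightarrow> (nat \<times> nat list) list" where
  "outgoing mem = map (\<lambda>x. (hd (list_decode x), [list_encode (tl (list_decode x))])) (tl mem)"

definition incoming :: "(nat \<times> nat list) list \<Rightarrow> nat list set" where
  "incoming ms = (\<lambda>(i, p). list_decode (hd p)) ` set ms"

definition fresh :: "nat list \<Rightarrow> bool" where
  "fresh mem \<longleftrightarrow> mem = [] \<or> hd mem < 2"

definition next_memory ::
    "nat \<Rightarrow> real \<Rightarrow> nat \<Rightarrow> nat \<Rightarrow> nat list \<Rightarrow> (nat \<times> nat list) list \<Rightarrow> nat list" where
  "next_memory d \<alpha> N i mem ms =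
     (if fresh mem then
        pack 2 (route (cell_code (num_machines \<alpha> N)) (num_machines \<alpha> N)
                      (\<lambda>k. the (map_of ms k)) (coded_items d mem))
      else if hd mem = 2 then pack 3 (label_locally i (incoming ms))
      else if hd mem = 3 then pack 4 (merge_labels i (incoming ms))
      else pack 5 (final_labels (incoming ms)))"

definition components_algorithm :: "nat \<Rightarrow> real \<Rightarrow> mpc_algorithm" where
  "components_algorithm d \<alpha> =
     \<lparr>msgs = (\<lambda>N i mem.
        if fresh mem then
          map (\<lambda>j. (j, stats (cell_code (num_machines \<alpha> N)) (num_machines \<alpha> N)
                            (sample_step \<alpha> N) (coded_items d mem)))
              [0..<num_machines \<alpha> N]
        else outgoing mem),
      compute = (\<lambda>N i mem ms. return_pmf (next_memory d \<alpha> N i mem ms)),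
      result = (\<lambda>N i mem.
        if mem \<noteq> [] \<and> hd mem = 5
        then Some (map (\<lambda>x. (list_decode (list_decode x ! 0), list_decode x ! 1)) (tl mem))
        else None)\<rparr>"

section \<open>Packed memories and message delivery\<close>

lemma set_word_list: "finite X \<Longrightarrow> set (word_list X) = X"
  by (simp add: word_list_def image_image)

lemma length_word_list: "length (word_list X) = card X"
  by (simp add: word_list_def card_image inj_list_encode)

lemma distinct_word_list: "distinct (word_list X)"
  by (simp add: word_list_def distinct_map inj_list_decode)

lemma length_pack: "length (pack t X) = card X + 1"
  by (simp add: pack_def length_word_list)

lemma set_pack: "finite X \<Longrightarrow> set (pack t X) = insert t (list_encode ` X)"
  by (simp add: pack_def set_word_list)

lemma outgoing_pack: "outgoing (pack t X) = map (\<lambda>w. (hd w, [list_encode (tl w)])) (word_list X)"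
  by (simp add: outgoing_def pack_def o_def)

lemma volume_outgoing: "volume (outgoing (pack t X)) = 2 * card X"
proof -
  have "volume (map (\<lambda>w. (hd w, [list_encode (tl w)])) ws) = 2 * length ws" for ws
    by (induction ws) (auto simp: volume_def)
  then show ?thesis by (simp add: outgoing_pack length_word_list)
qed

lemma set_inbox:
  "set (inbox A \<alpha> N \<sigma> j) = {(i, p). i < num_machines \<alpha> N \<and> (j, p) \<in> set (msgs A N i (\<sigma> i))}"
  by (force simp: inbox_def)

lemma volume_concat: "volume (concat ls) = sum_list (map volume ls)"
  by (induction ls) (auto simp: volume_def)

lemma volume_inbox:
  "volume (inbox A \<alpha> N \<sigma> j) =
     (\<Sum>i<num_machines \<alpha> N. volume (filter (\<lambda>(k, p). k = j) (msgs A N i (\<sigma> i))))"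
proof -
  have "volume (map (\<lambda>(k, p). (i, p)) ms) = volume ms" for i :: nat and ms :: "(nat \<times> nat list) list"
    by (induction ms) (auto simp: volume_def)
  then show ?thesis
    by (simp add: inbox_def volume_concat o_def interv_sum_list_conv_sum_set_nat atLeast0LessThan)
qed

context
  fixes A :: mpc_algorithm and \<alpha> :: real and N t :: nat and \<sigma> :: config and X :: "nat \<Rightarrow> nat list set"
  assumes packed: "\<And>i. i < num_machines \<alpha> N \<Longrightarrow> msgs A N i (\<sigma> i) = outgoing (pack t (X i))"
    and fin: "\<And>i. i < num_machines \<alpha> N \<Longrightarrow> finite (X i)"
    and nonempty: "\<And>i w. i < num_machines \<alpha> N \<Longrightarrow> w \<in> X i \<Longrightarrow> w \<noteq> []"
begin

lemma incoming_inbox: "incoming (inbox A \<alpha> N \<sigma> j) = delivered (num_machines \<alpha> N) X j"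
proof -
  have "w \<in> incoming (inbox A \<alpha> N \<sigma> j) \<longleftrightarrow> w \<in> delivered (num_machines \<alpha> N) X j" for w
  proof
    assume "w \<in> incoming (inbox A \<alpha> N \<sigma> j)"
    then obtain i v where i: "i < num_machines \<alpha> N" "v \<in> X i" "hd v = j" "w = tl v"
      by (auto simp: incoming_def set_inbox packed outgoing_pack fin set_word_list)
    with nonempty[OF i(1,2)] have "j # w \<in> X i" by (metis list.collapse)
    with i(1) show "w \<in> delivered (num_machines \<alpha> N) X j" by (auto simp: delivered_def)
  next
    assume "w \<in> delivered (num_machines \<alpha> N) X j"
    then obtain i where i: "i < num_machines \<alpha> N" "j # w \<in> X i" by (auto simp: delivered_def)
    then have "(i, [list_encode w]) \<in> set (inbox A \<alpha> N \<sigma> j)"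
      by (force simp: set_inbox packed outgoing_pack fin set_word_list)
    then show "w \<in> incoming (inbox A \<alpha> N \<sigma> j)" by (force simp: incoming_def)
  qed
  then show ?thesis by blast
qed

lemma volume_inbox_packed: "volume (inbox A \<alpha> N \<sigma> j) = 2 * received (num_machines \<alpha> N) X j"
proof -
  have "volume (filter (\<lambda>(k, p). k = j) (msgs A N i (\<sigma> i))) = 2 * card {w. j # w \<in> X i}"
    if i: "i < num_machines \<alpha> N" for i
  proof -
    have "volume (filter (\<lambda>(k, p). k = j) (map (\<lambda>w. (hd w, [list_encode (tl w)])) ws))
        = 2 * length (filter (\<lambda>w. hd w = j) ws)" for ws
      by (induction ws) (auto simp: volume_def)
    moreover have "length (filter (\<lambda>w. hd w = j) (word_list (X i))) = card {w \<in> X i. hd w = j}"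
      using distinct_card[OF distinct_filter[OF distinct_word_list]] fin[OF i]
      by (metis set_filter set_word_list)
    moreover have "{w \<in> X i. hd w = j} = (\<lambda>w. j # w) ` {w. j # w \<in> X i}"
    proof -
      have "w \<in> (\<lambda>w. j # w) ` {w. j # w \<in> X i}" if "w \<in> X i" "hd w = j" for w
        using that nonempty[OF i that(1)] by (cases w) auto
      then show ?thesis by auto
    qed
    ultimately show ?thesis by (simp add: packed[OF i] outgoing_pack card_image)
  qed
  then show ?thesis by (simp add: volume_inbox received_def sum_distrib_left)
qed

end

text \<open>The inbox does not depend on the receiver, which is why all machines agree on the shift
  and on the owners.\<close>

lemma inbox_all_to_all:
  assumes "\<And>i. i < num_machines \<alpha> N \<Longrightarrow> msgs A N i (\<sigma> i) = map (\<lambda>j. (j, f i)) [0..<num_machines \<alpha> N]"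
    and "j < num_machines \<alpha> N"
  shows "inbox A \<alpha> N \<sigma> j = map (\<lambda>i. (i, f i)) [0..<num_machines \<alpha> N]"
proof -
  have one: "filter (\<lambda>(k, p). k = j) (map (\<lambda>k. (k, x)) [0..<n]) = (if j < n then [(j, x)] else [])"
    for n and x :: "nat list"
    by (induction n) auto
  have "map (\<lambda>(k, p). (i, p)) (filter (\<lambda>(k, p). k = j) (msgs A N i (\<sigma> i))) = [(i, f i)]"
    if "i < num_machines \<alpha> N" for i
    using that assms by (simp add: one)
  then have eq: "map (\<lambda>i. map (\<lambda>(k, p). (i, p)) (filter (\<lambda>(k, p). k = j) (msgs A N i (\<sigma> i)))) [0..<num_machines \<alpha> N]
     = map (\<lambda>i. [(i, f i)]) [0..<num_machines \<alpha> N]"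
    by (intro map_cong) auto
  show ?thesis unfolding inbox_def eq by (simp add: concat_map_singleton)
qed

lemma volume_map_const: "volume (map (\<lambda>i. (g i, f i)) ks) = (\<Sum>i\<leftarrow>ks. length (f i) + 1)"
  by (induction ks) (auto simp: volume_def)

lemma length_stats: "length (stats ce m q ps) = m * (m + 1)"
  by (simp add: stats_def)

lemma compute_components_algorithm:
  "compute (components_algorithm d \<alpha>) N i mem ms = return_pmf (next_memory d \<alpha> N i mem ms)"
  by (simp add: components_algorithm_def)

lemma mpc_round_components_algorithm:
  assumes "\<not> terminated (components_algorithm d \<alpha>) \<alpha> N \<sigma>"
  shows "mpc_round (components_algorithm d \<alpha>) \<alpha> N \<sigma> =
    return_pmf (\<lambda>i. if i < num_machines \<alpha> N
      then next_memory d \<alpha> N i (\<sigma> i) (inbox (components_algorithm d \<alpha>) \<alpha> N \<sigma> i) else [])"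
  using assms by (simp add: mpc_round_def compute_components_algorithm)

text \<open>As \<open>f\<close> is constant on each component and separates different ones, its
  value at an arbitrary member can serve as the ID.\<close>

lemma labels_componentsI:
  assumes "\<And>u v. u \<in> V \<Longrightarrow> v \<in> V \<Longrightarrow> f u = f v \<longleftrightarrow> (u, v) \<in> connectivity V E"
  shows "labels_components V E {(v, f v) |v. v \<in> V}"
proof -
  have same: "f v = f u" if "K \<in> connected_components V E" "u \<in> K" "v \<in> K" for K u v
  proof -
    from that(1) obtain x where "x \<in> V" "K = connectivity V E `` {x}"
      by (auto simp: connected_components_def quotient_def)
    then show ?thesis
      using assms[of x u] assms[of x v] that(2,3) by (auto simp: connectivity_def)
  qed
  have sub: "u \<in> V" if "K \<in> connected_components V E" "u \<in> K" for K u
    using that by (auto simp: connected_components_def quotient_def connectivity_def)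
  have conn: "v \<in> K \<longleftrightarrow> f v = f u"
    if "K \<in> connected_components V E" "u \<in> K" "v \<in> V" for K u v
  proof -
    from that(1) obtain x where x: "x \<in> V" "K = connectivity V E `` {x}"
      by (auto simp: connected_components_def quotient_def)
    then have "f x = f u" using assms[of x u] sub[OF that(1,2)] that(2) by auto
    then show ?thesis using assms[of x v] x that(3) by auto
  qed
  have self: "v \<in> connectivity V E `` {v}" "connectivity V E `` {v} \<in> connected_components V E"
    if "v \<in> V" for v
    using that by (auto simp: connectivity_def connected_components_def quotient_def)
  have ne: "K \<noteq> {}" if "K \<in> connected_components V E" for K
    using that by (auto simp: connected_components_def quotient_def connectivity_def)
  define ID where "ID K = f (SOME v. v \<in> K)" for K
  have ID: "ID K = f v" if "K \<in> connected_components V E" "v \<in> K" for K v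
    unfolding ID_def using same[OF that(1) that(2)] that(2) by (metis someI)
  have "inj_on ID (connected_components V E)"
  proof
    fix K L assume KL: "K \<in> connected_components V E" "L \<in> connected_components V E" "ID K = ID L"
    obtain u v where uv: "u \<in> K" "v \<in> L" using ne KL by blast
    then have "f u = f v" using KL ID by metis
    then have "x \<in> K \<longleftrightarrow> x \<in> L" if "x \<in> V" for x using conn KL uv that by metis
    then show "K = L" using sub KL by blast
  qed
  moreover have "{(v, f v) |v. v \<in> V} = {(v, ID K) |v K. K \<in> connected_components V E \<and> v \<in> K}"
  proof -
    have "\<exists>K. K \<in> connected_components V E \<and> v \<in> K \<and> f v = ID K" if "v \<in> V" for v
      using self[OF that] ID by metis
    then show ?thesis using ID sub by fastforce
  qed
  ultimately show ?thesis unfolding labels_components_def by blast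
qed

section \<open>Grid graphs as cell decompositions\<close>

text \<open>\<open>N / s\<close> equals \<open>N powr (1 - \<alpha>)\<close>, which is at least 1,
  so rounding up at most doubles it.\<close>

lemma num_machines_bounds:
  assumes N: "0 < N" and "0 \<le> \<alpha>" "\<alpha> < 1"
  shows "real N powr (1 - \<alpha>) \<le> real (num_machines \<alpha> N)"
    and "real (num_machines \<alpha> N) \<le> 2 * real N powr (1 - \<alpha>)"
    and "0 < num_machines \<alpha> N" and "num_machines \<alpha> N \<le> N"
proof -
  define x where "x = real N powr (1 - \<alpha>)"
  have x1: "1 \<le> x" using assms by (simp add: x_def ge_one_powr_ge_zero)
  have "x = real N / local_space \<alpha> N" using N by (simp add: x_def local_space_def powr_diff)
  then have m: "num_machines \<alpha> N = nat \<lceil>x\<rceil>" by (simp add: num_machines_def)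
  have m': "real (num_machines \<alpha> N) = of_int \<lceil>x\<rceil>" using x1 unfolding m by simp
  show "real N powr (1 - \<alpha>) \<le> real (num_machines \<alpha> N)"
    unfolding m' x_def[symmetric] by (rule le_of_int_ceiling)
  have "of_int \<lceil>x\<rceil> \<le> x + 1" by (rule of_int_ceiling_le_add_one)
  then show "real (num_machines \<alpha> N) \<le> 2 * real N powr (1 - \<alpha>)"
    using x1 unfolding m' x_def[symmetric] by linarith
  show "0 < num_machines \<alpha> N" using x1 unfolding m by simp
  have "x \<le> real N powr 1" unfolding x_def using assms by (intro powr_mono) auto
  then have "\<lceil>x\<rceil> \<le> int N" by (simp add: ceiling_le_iff)
  then show "num_machines \<alpha> N \<le> N" unfolding m by linarith
qed

text \<open>Used with \<open>k = 3\<close> for the exchange of the statistics and with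
  \<open>k = d\<close> for the content of a cell. The condition says that \<open>\<alpha>\<close> is
  at least \<open>k / (k + 1)\<close>, which is \<open>3 / 4\<close> in the first case.\<close>

lemma num_machines_power_le:
  assumes "0 < N" "0 \<le> \<alpha>" "\<alpha> < 1" "real k * (1 - \<alpha>) \<le> \<alpha>"
  shows "real (num_machines \<alpha> N ^ k) \<le> 2 ^ k * local_space \<alpha> N"
proof -
  have "real (num_machines \<alpha> N ^ k) \<le> (2 * real N powr (1 - \<alpha>)) ^ k"
    unfolding of_nat_power using num_machines_bounds(2)[OF assms(1-3)] by (intro power_mono) auto
  also have "\<dots> = 2 ^ k * real N powr (real k * (1 - \<alpha>))"
    using assms(1) by (simp add: power_mult_distrib powr_power)
  also have "real N powr (real k * (1 - \<alpha>)) \<le> real N powr \<alpha>"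
    using assms by (intro powr_mono) auto
  finally show ?thesis by (simp add: local_space_def)
qed

lemma share_bounds:
  assumes N: "0 < N" and "0 \<le> \<alpha>" "\<alpha> < 1"
  shows "real N / real (num_machines \<alpha> N) \<le> local_space \<alpha> N"
    and "real (share \<alpha> N) \<le> 2 * local_space \<alpha> N"
    and "share \<alpha> N \<le> N"
proof -
  let ?m = "real (num_machines \<alpha> N)"
  note m = num_machines_bounds[OF assms]
  have "real N / ?m \<le> real N / real N powr (1 - \<alpha>)"
    using m(1,3) N by (intro divide_left_mono) auto
  also have "\<dots> = local_space \<alpha> N" using N by (simp add: local_space_def powr_diff)
  finally show le: "real N / ?m \<le> local_space \<alpha> N" .
  have "1 \<le> local_space \<alpha> N" using assms by (simp add: local_space_def ge_one_powr_ge_zero)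
  moreover have "of_int \<lceil>real N / ?m\<rceil> \<le> real N / ?m + 1" by (rule of_int_ceiling_le_add_one)
  moreover have "real (share \<alpha> N) = of_int \<lceil>real N / ?m\<rceil>"
    using N m(3) by (simp add: share_def)
  ultimately show "real (share \<alpha> N) \<le> 2 * local_space \<alpha> N" using le by linarith
  have "real N / ?m \<le> real N" using m(3) N by (simp add: divide_le_eq)
  then have "\<lceil>real N / ?m\<rceil> \<le> int N" by (simp add: ceiling_le_iff)
  then show "share \<alpha> N \<le> N" unfolding share_def by linarith
qed

text \<open>Covers both kinds of items: the two ends of an edge in either orientation, and the pair
  \<open>(v, v)\<close> of a node.\<close>

definition near :: "nat \<Rightarrow> nat \<Rightarrow> (point \<times> point) set" where
  "near d c = {(u, v). length u = d \<and> length v = d \<and>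
     (\<forall>k<d. \<bar>int (u ! k) - int (v ! k)\<bar> \<le> int c)}"

lemma near_sym: "(u, v) \<in> near d c \<longleftrightarrow> (v, u) \<in> near d c"
  by (auto simp: near_def abs_minus_commute)

lemma cell_code_list_encode:
  "cell_code m r (list_encode u) = list_encode (map (\<lambda>x. (x + r) div m) u)"
  by (simp add: cell_code_def)

lemma list_encode_eq_iff: "list_encode u = list_encode v \<longleftrightarrow> u = v"
  by (metis list_encode_inverse)

text \<open>The first point has at most \<open>m ^ d\<close> positions in the cell, the second at
  most \<open>(2 * c + 1) ^ d\<close> positions around the first. This bounds the items with a given
  end in a cell, independently of the input.\<close>

lemma card_near_cell_le:
  assumes "0 < m"
  shows "finite {p \<in> near d c. cell_code m r (list_encode (fst p)) = key}"
    and "card {p \<in> near d c. cell_code m r (list_encode (fst p)) = key} \<le> m ^ d * (2 * c + 1) ^ d"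
proof -
  define A where "A = {u :: point. length u = d \<and> map (\<lambda>x. (x + r) div m) u = list_decode key}"
  define B where "B u = {v :: point. length v = d \<and> (\<forall>k<d. \<bar>int (u ! k) - int (v ! k)\<bar> \<le> int c)}"
    for u :: point
  have sub: "{p \<in> near d c. cell_code m r (list_encode (fst p)) = key} \<subseteq> Sigma A B"
    by (auto simp: near_def A_def B_def cell_code_list_encode)
  have A: "finite A" "card A \<le> m ^ d" unfolding A_def using card_cell_le[OF assms] by auto
  have B: "finite (B u)" "card (B u) \<le> (2 * c + 1) ^ d" if "u \<in> A" for u
    using card_neighbours_le[of u d c] that by (auto simp: A_def B_def)
  have fin: "finite (Sigma A B)" using A B by auto
  show "finite {p \<in> near d c. cell_code m r (list_encode (fst p)) = key}"
    by (rule finite_subset[OF sub fin])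
  have "card (Sigma A B) = (\<Sum>u\<in>A. card (B u))" using A B by (simp add: card_SigmaI)
  also have "\<dots> \<le> card A * (2 * c + 1) ^ d"
    using sum_bounded_above[of A "\<lambda>u. card (B u)" "(2 * c + 1) ^ d"] B by simp
  also have "\<dots> \<le> m ^ d * (2 * c + 1) ^ d" using A by simp
  finally show "card {p \<in> near d c. cell_code m r (list_encode (fst p)) = key} \<le> m ^ d * (2 * c + 1) ^ d"
    using card_mono[OF fin sub] by linarith
qed

lemma linf_dist_near:
  assumes "length u = d" "length v = d" "linf_dist d u v \<le> int c"
  shows "(u, v) \<in> near d c"
proof -
  have "\<bar>int (u ! k) - int (v ! k)\<bar> \<le> linf_dist d u v" if "k < d" for k
    unfolding linf_dist_def using that by (intro Max_ge) auto
  then show ?thesis using assms by (fastforce simp: near_def)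
qed

lemma linf_dist_self: "0 < d \<Longrightarrow> linf_dist d u u = 0"
proof -
  assume "0 < d"
  then have "(\<lambda>i. \<bar>int (u ! i) - int (u ! i)\<bar>) ` {..<d} = {0}" by auto
  then show ?thesis unfolding linf_dist_def by simp
qed

section \<open>A placed grid graph as a decomposition\<close>

locale components_instance =
  fixes d c :: nat and \<alpha> :: real and V :: "point set" and E :: "point set set" and D :: "nat \<Rightarrow> item list"
  assumes d: "2 \<le> d" and \<alpha>: "3 / 4 \<le> \<alpha>" "(real d + 1) / (real d + 2) < \<alpha>" "\<alpha> < 1"
    and grid: "grid_graph d c V E" and even: "even_distribution \<alpha> V E D"
    and N_pos: "0 < graph_size V E"
begin

definition "N = graph_size V E"
definition "m = num_machines \<alpha> N"
definition "pl i = coded_items d (initial_config D i)"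
definition "items = concat (map D [0..<m])"
definition "code_ends it = map_prod list_encode list_encode (ends it)"

lemma N: "0 < N" using N_pos by (simp add: N_def)
lemma \<alpha>0: "0 \<le> \<alpha>" using \<alpha> by simp

lemmas m_bounds = num_machines_bounds[OF N \<alpha>0 \<alpha>(3), folded m_def]

lemma finV: "finite V" using grid by (simp add: grid_graph_def)

lemma length_V: "v \<in> V \<Longrightarrow> length v = d" using grid by (simp add: grid_graph_def)

lemma finE: "finite E"
proof -
  have "E \<subseteq> Pow V" using grid by (fastforce simp: grid_graph_def)
  then show ?thesis using finV by (simp add: finite_subset)
qed

lemma edge:
  assumes "{u, v} \<in> E"
  shows "u \<in> V" "v \<in> V" "u \<noteq> v" "(u, v) \<in> near d c"
proof -
  obtain u' v' where *: "u' \<in> V" "v' \<in> V" "{u, v} = {u', v'}"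
    "0 < linf_dist d u' v'" "linf_dist d u' v' \<le> int c"
    using grid assms unfolding grid_graph_def by blast
  have "(u', v') \<in> near d c" using *(1,2,5) by (intro linf_dist_near length_V)
  moreover have "u' \<noteq> v'" using *(4) linf_dist_self[of d v'] d by auto
  moreover have "u = u' \<and> v = v' \<or> u = v' \<and> v = u'" using *(3) by (simp add: doubleton_eq_iff)
  ultimately show "u \<in> V" "v \<in> V" "u \<noteq> v" "(u, v) \<in> near d c"
    using *(1,2) near_sym by blast+
qed

lemma items_denote: "distinct (map denotes items)" "set (map denotes items) = Inl ` V \<union> Inr ` E"
  and length_D: "i < m \<Longrightarrow> length (D i) \<le> share \<alpha> N"
  using even by (auto simp: even_distribution_def Let_def items_def m_def N_def share_def le_nat_iff)

lemma item_cases: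
  assumes "it \<in> set items"
  obtains (node) v where "it = Node v" "v \<in> V" | (edge) u v where "it = Edge u v" "{u, v} \<in> E"
proof -
  have "denotes it \<in> Inl ` V \<union> Inr ` E" using assms items_denote(2) by auto
  then show ?thesis using that by (cases it) auto
qed

lemma ends_V:
  assumes "it \<in> set items"
  shows "fst (ends it) \<in> V" "snd (ends it) \<in> V"
  using assms by (cases rule: item_cases; auto dest: edge)+

lemma D_items: "i < m \<Longrightarrow> it \<in> set (D i) \<Longrightarrow> it \<in> set items"
  by (auto simp: items_def)

lemma pl_eq: "i < m \<Longrightarrow> pl i = map code_ends (D i)"
  unfolding pl_def coded_items_def initial_config_def
  using ends_V[OF D_items] by (subst parse_items_item_words) (auto simp: length_V code_ends_def)

lemma concat_pl: "concat (map pl [0..<m]) = map code_ends items"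
proof -
  have eq: "map pl [0..<m] = map (\<lambda>i. map code_ends (D i)) [0..<m]"
    by (rule map_cong) (auto simp: pl_eq)
  show ?thesis unfolding eq by (simp add: items_def map_concat o_def)
qed

lemma near_ends: "it \<in> set items \<Longrightarrow> ends it \<in> near d c"
  by (cases rule: item_cases) (auto simp: near_def length_V dest: edge)

text \<open>The object denoted by an item can be recovered from its coded ends: equal ends mean a
  node, because the ends of an edge have positive distance.\<close>

lemma distinct_pl: "distinct (concat (map pl [0..<m]))"
proof -
  define g where "g = (\<lambda>(a, b). if a = b then Inl (list_decode a) else Inr {list_decode a, list_decode b})"
  have "g (code_ends it) = denotes it" if "it \<in> set items" for it
    using that by (cases rule: item_cases) (auto simp: g_def code_ends_def list_encode_eq_iff dest: edge)
  then have eq: "map g (map code_ends items) = map denotes items" by simp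
  have "distinct (map g (map code_ends items))" unfolding eq by (rule items_denote(1))
  then show ?thesis unfolding concat_pl distinct_map[of g] by blast
qed

sublocale decomposition pl "cell_code m" m "sample_step \<alpha> N" "share \<alpha> N"
  "m ^ d * (2 * c + 1) ^ d" "d * c" "set (concat (map pl [0..<m]))"
proof unfold_locales
  show "0 < m" by (rule m_bounds(3))
  show "distinct (concat (map pl [0..<m]))" by (rule distinct_pl)
  show "length (pl i) \<le> share \<alpha> N" if "i < m" for i using length_D[OF that] by (simp add: pl_eq that)
  show "0 < sample_step \<alpha> N" by (simp add: sample_step_def)
  have "2 * share \<alpha> N = 2 * share \<alpha> N div m * m + 2 * share \<alpha> N mod m" by simp
  moreover have "2 * share \<alpha> N mod m < m" using m_bounds(3) by simp
  ultimately have "2 * share \<alpha> N \<le> 2 * share \<alpha> N div m * m + m" by linarith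
  then show "2 * share \<alpha> N \<le> m * sample_step \<alpha> N"
    by (simp add: sample_step_def m_def[symmetric] algebra_simps)
  have near: "\<exists>u v. (u, v) \<in> near d c \<and> a = list_encode u \<and> b = list_encode v"
    if ab: "(a, b) \<in> set (concat (map pl [0..<m]))" for a b
  proof -
    obtain it where it: "it \<in> set items" "(a, b) = code_ends it"
      using ab unfolding concat_pl set_map by blast
    then show ?thesis using near_ends[OF it(1)] by (cases "ends it") (auto simp: code_ends_def)
  qed
  show "card {r. r < m \<and> cell_code m r a \<noteq> cell_code m r b} \<le> d * c"
    if ab: "(a, b) \<in> set (concat (map pl [0..<m]))" for a b
  proof -
    obtain u v where "(u, v) \<in> near d c" "a = list_encode u" "b = list_encode v"
      using near[OF ab] by blast
    then show ?thesis using card_shifts_separating_points_le[OF m_bounds(3), of u d v c]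
      by (auto simp: near_def cell_code_list_encode list_encode_eq_iff)
  qed
  let ?e = "map_prod list_encode list_encode"
  show "card {p \<in> set (concat (map pl [0..<m])). cell_code m r (fst p) = k} \<le> m ^ d * (2 * c + 1) ^ d" for r k
  proof -
    have "{p \<in> set (concat (map pl [0..<m])). cell_code m r (fst p) = k}
        \<subseteq> ?e ` {p \<in> near d c. cell_code m r (list_encode (fst p)) = k}"
    proof
      fix p assume p: "p \<in> {p \<in> set (concat (map pl [0..<m])). cell_code m r (fst p) = k}"
      then obtain u v where "(u, v) \<in> near d c" "p = (list_encode u, list_encode v)"
        using near[of "fst p" "snd p"] by (auto simp: prod_eq_iff)
      then show "p \<in> ?e ` {p \<in> near d c. cell_code m r (list_encode (fst p)) = k}"
        using p by (intro image_eqI[of _ _ "(u, v)"]) auto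
    qed
    from surj_card_le[OF card_near_cell_le(1)[OF m_bounds(3)] this]
    show ?thesis using card_near_cell_le(2)[OF m_bounds(3)] by (rule order_trans)
  qed
  \<comment> \<open>\<open>near\<close> is symmetric, so swapping the pair reduces the second end to
    the first.\<close>
  show "card {p \<in> set (concat (map pl [0..<m])). cell_code m r (snd p) = k} \<le> m ^ d * (2 * c + 1) ^ d" for r k
  proof -
    have "{p \<in> set (concat (map pl [0..<m])). cell_code m r (snd p) = k}
        \<subseteq> (prod.swap \<circ> ?e) ` {p \<in> near d c. cell_code m r (list_encode (fst p)) = k}"
    proof
      fix p assume p: "p \<in> {p \<in> set (concat (map pl [0..<m])). cell_code m r (snd p) = k}"
      then obtain u v where "(u, v) \<in> near d c" "p = (list_encode u, list_encode v)"
        using near[of "fst p" "snd p"] by (auto simp: prod_eq_iff)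
      moreover from this have "(v, u) \<in> near d c" using near_sym[of u v] by blast
      ultimately show "p \<in> (prod.swap \<circ> ?e) ` {p \<in> near d c. cell_code m r (list_encode (fst p)) = k}"
        using p by (intro image_eqI[of _ _ "(v, u)"]) auto
    qed
    from surj_card_le[OF card_near_cell_le(1)[OF m_bounds(3)] this]
    show ?thesis using card_near_cell_le(2)[OF m_bounds(3)] by (rule order_trans)
  qed
qed

section \<open>Links between codes and connectivity of the graph\<close>

lemma P_eq: "set (concat (map pl [0..<m])) = code_ends ` set items"
  by (simp only: concat_pl set_map)

lemma card_P: "card (set (concat (map pl [0..<m]))) = N"
proof -
  have "card (set (concat (map pl [0..<m]))) = length items"
    using distinct_card[OF distinct_pl] by (simp only: concat_pl length_map)
  also have "\<dots> = card (Inl ` V \<union> Inr ` E :: (point + point set) set)"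
    using distinct_card[OF items_denote(1)] items_denote(2) by simp
  also have "\<dots> = N"
    using finV finE by (subst card_Un_disjoint) (auto simp: card_image N_def graph_size_def)
  finally show ?thesis .
qed

lemma node_in_P: "(list_encode v, list_encode v) \<in> set (concat (map pl [0..<m])) \<longleftrightarrow> v \<in> V"
proof
  assume "v \<in> V"
  then have "Inl v \<in> set (map denotes items)" using items_denote(2) by auto
  then obtain it where it: "it \<in> set items" "denotes it = Inl v" by auto
  have "code_ends it = (list_encode v, list_encode v)"
    using it(2) by (cases it) (auto simp: code_ends_def)
  then show "(list_encode v, list_encode v) \<in> set (concat (map pl [0..<m]))"
    unfolding P_eq using it(1) by (metis imageI)
next
  assume "(list_encode v, list_encode v) \<in> set (concat (map pl [0..<m]))"
  then obtain it where it: "it \<in> set items" "(list_encode v, list_encode v) = code_ends it"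
    unfolding P_eq by blast
  then show "v \<in> V" using ends_V(1)[OF it(1)]
    by (cases "ends it") (auto simp: code_ends_def list_encode_eq_iff)
qed

lemma S_D:
  assumes "(a, b) \<in> S"
  obtains u v where "a = list_encode u" "b = list_encode v" "u = v \<or> {u, v} \<in> E" "u \<in> V" "v \<in> V"
proof -
  have ex: "\<exists>u v. a = list_encode u \<and> b = list_encode v \<and> (u = v \<or> {u, v} \<in> E) \<and> u \<in> V \<and> v \<in> V"
    if it: "it \<in> set items" "code_ends it = (a, b)" for it a b
    using it(1)
  proof (cases rule: item_cases)
    case (node v)
    then show ?thesis using it(2) by (auto simp: code_ends_def)
  next
    case (edge u v)
    then show ?thesis using it(2) components_instance.edge[OF components_instance_axioms edge(2)]
      by (auto simp: code_ends_def)
  qed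
  from assms have "(a, b) \<in> code_ends ` set items \<or> (b, a) \<in> code_ends ` set items"
    unfolding S_def P_eq by blast
  then consider it where "it \<in> set items" "code_ends it = (a, b)"
    | it where "it \<in> set items" "code_ends it = (b, a)"
    by (metis imageE)
  then show ?thesis
  proof cases
    case 1
    then show ?thesis using ex that by blast
  next
    case 2
    from ex[OF this] obtain u v where uv: "b = list_encode u" "a = list_encode v"
      "u = v \<or> {u, v} \<in> E" "u \<in> V" "v \<in> V" by blast
    then show ?thesis using that[of v u] insert_commute[of u v "{}"] by metis
  qed
qed

lemma edge_in_S:
  assumes "{u, v} \<in> E"
  shows "(list_encode u, list_encode v) \<in> S"
proof -
  have "Inr {u, v} \<in> set (map denotes items)" using assms items_denote(2) by auto
  then obtain it where it: "it \<in> set items" "denotes it = Inr {u, v}" by auto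
  have "ends it = (u, v) \<or> ends it = (v, u)"
    using it(2) by (cases it) (auto simp: doubleton_eq_iff)
  then have "code_ends it = (list_encode u, list_encode v) \<or> code_ends it = (list_encode v, list_encode u)"
    by (auto simp: code_ends_def)
  then have "(list_encode u, list_encode v) \<in> code_ends ` set items \<or>
      (list_encode v, list_encode u) \<in> code_ends ` set items"
    using it(1) by (metis imageI)
  then show ?thesis unfolding S_def P_eq by blast
qed

text \<open>On codes \<open>S\<close> consists of the edges and of loops at the nodes, and loops do
  not change the reflexive transitive closure.\<close>

lemma connected_iff:
  assumes "u \<in> V" "v \<in> V"
  shows "(list_encode u, list_encode v) \<in> S\<^sup>* \<longleftrightarrow> (u, v) \<in> connectivity V E"
proof -
  let ?E = "{(u, v). {u, v} \<in> E}"
  have "\<exists>w. b = list_encode w \<and> (u, w) \<in> ?E\<^sup>*" if "(list_encode u, b) \<in> S\<^sup>*" for b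
    using that
  proof (induction rule: rtrancl_induct)
    case (step a b)
    then obtain w where w: "a = list_encode w" "(u, w) \<in> ?E\<^sup>*" by blast
    from step(2) obtain w' x where wx: "a = list_encode w'" "b = list_encode x" "w' = x \<or> {w', x} \<in> E"
      by (rule S_D)
    with w(1) have "w' = w" by (simp add: list_encode_eq_iff)
    with wx(3) have "w = x \<or> (w, x) \<in> ?E" by simp
    then have "(u, x) \<in> ?E\<^sup>*" using w(2) rtrancl.rtrancl_into_rtrancl[OF w(2), of x] by blast
    with wx(2) show ?case by blast
  qed blast
  moreover have "(list_encode u, list_encode w) \<in> S\<^sup>*" if "(u, w) \<in> ?E\<^sup>*" for w
    using that
  proof (induction rule: rtrancl_induct)
    case (step y z)
    then show ?case using edge_in_S[of y z] by (auto intro: rtrancl.rtrancl_into_rtrancl)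
  qed blast
  ultimately have "(list_encode u, list_encode v) \<in> S\<^sup>* \<longleftrightarrow> (u, v) \<in> ?E\<^sup>*"
    by (metis list_encode_inverse)
  then show ?thesis using assms by (simp add: connectivity_def)
qed

end

section \<open>Runs and resource bounds\<close>

lemma fresh_pack: "fresh (pack t X) \<longleftrightarrow> t < 2"
  by (simp add: fresh_def pack_def)

lemma fresh_item_words: "fresh (concat (map item_words its))"
proof (cases its)
  case (Cons it its')
  then show ?thesis by (cases it) (auto simp: fresh_def)
qed (simp add: fresh_def)

lemma next_memory_pack:
  "2 \<le> t \<Longrightarrow> next_memory d \<alpha> N i (pack t X) ms =
     (if t = 2 then pack 3 (label_locally i (incoming ms))
      else if t = 3 then pack 4 (merge_labels i (incoming ms))
      else pack 5 (final_labels (incoming ms)))"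
  by (simp add: next_memory_def fresh_pack) (simp add: pack_def)

lemma msgs_pack: "2 \<le> t \<Longrightarrow> msgs (components_algorithm d \<alpha>) N i (pack t X) = outgoing (pack t X)"
  by (simp add: components_algorithm_def fresh_pack)

lemma result_pack:
  "result (components_algorithm d \<alpha>) N i (pack t X) =
     (if t = 5 then Some (map (\<lambda>w. (list_decode (w ! 0), w ! 1)) (word_list X)) else None)"
  by (simp add: components_algorithm_def pack_def o_def)

lemma result_fresh: "fresh mem \<Longrightarrow> result (components_algorithm d \<alpha>) N i mem = None"
  by (auto simp: components_algorithm_def fresh_def)

context components_instance
begin

abbreviation "alg \<equiv> components_algorithm d \<alpha>"

definition cfg :: "nat \<Rightarrow> (nat \<Rightarrow> nat list set) \<Rightarrow> config" where
  "cfg t Y i = (if i < m then pack t (Y i) else [])"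

text \<open>All distributions used are concentrated on one point, so this is the only trajectory,
  and properties of every possible run become properties of five configurations. After the fourth
  round it stands still.\<close>

definition config_at :: "nat \<Rightarrow> config" where
  "config_at t =
     (if t = 0 then initial_config D else if t = 1 then cfg 2 X1 else if t = 2 then cfg 3 X2
      else if t = 3 then cfg 4 X3 else cfg 5 X4)"

lemma terminated_cfg: "terminated alg \<alpha> N (cfg t Y) \<longleftrightarrow> t = 5"
  using m_bounds(3) by (auto simp: terminated_def m_def[symmetric] cfg_def result_pack split: if_splits)

lemma fresh_initial: "fresh (initial_config D i)"
  by (simp add: initial_config_def fresh_item_words)

lemma not_terminated_initial: "\<not> terminated alg \<alpha> N (initial_config D)"
  using m_bounds(3) by (auto simp: terminated_def m_def[symmetric] result_fresh fresh_initial)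

lemma msgs_initial:
  "msgs alg N i (initial_config D i)
     = map (\<lambda>j. (j, stats (cell_code m) m (sample_step \<alpha> N) (pl i))) [0..<m]"
  by (simp add: components_algorithm_def fresh_initial pl_def m_def)

lemma inbox_initial:
  "j < m \<Longrightarrow> inbox alg \<alpha> N (initial_config D) j
     = map (\<lambda>i. (i, stats (cell_code m) m (sample_step \<alpha> N) (pl i))) [0..<m]"
  unfolding m_def by (rule inbox_all_to_all) (simp_all add: msgs_initial m_def)

lemma round_initial: "mpc_round alg \<alpha> N (initial_config D) = return_pmf (cfg 2 X1)"
proof -
  have "next_memory d \<alpha> N i (initial_config D i) (inbox alg \<alpha> N (initial_config D) i) = pack 2 (X1 i)"
    if "i < m" for i
    unfolding inbox_initial[OF that] next_memory_def m_def[symmetric]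
    by (simp add: fresh_initial X1_def st_def pl_def)
  then have "(\<lambda>i. if i < m then next_memory d \<alpha> N i (initial_config D i)
      (inbox alg \<alpha> N (initial_config D) i) else []) = cfg 2 X1"
    by (auto simp: cfg_def)
  then show ?thesis
    using mpc_round_components_algorithm[OF not_terminated_initial] by (simp add: m_def)
qed

lemma msgs_cfg: "2 \<le> t \<Longrightarrow> i < m \<Longrightarrow> msgs alg N i (cfg t Y i) = outgoing (pack t (Y i))"
  by (simp add: cfg_def msgs_pack)

lemma incoming_cfg:
  assumes "2 \<le> t" "\<And>i. i < m \<Longrightarrow> finite (Y i)" "\<And>i w. i < m \<Longrightarrow> w \<in> Y i \<Longrightarrow> w \<noteq> []"
  shows "incoming (inbox alg \<alpha> N (cfg t Y) j) = delivered m Y j"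
    and "volume (inbox alg \<alpha> N (cfg t Y) j) = 2 * received m Y j"
  unfolding m_def
  by (rule incoming_inbox volume_inbox_packed; use assms in \<open>simp add: msgs_cfg flip: m_def\<close>)+

lemma round_cfg:
  assumes "t \<noteq> 5"
    and "\<And>i. i < m \<Longrightarrow> next_memory d \<alpha> N i (pack t (Y i)) (inbox alg \<alpha> N (cfg t Y) i) = pack t' (Y' i)"
  shows "mpc_round alg \<alpha> N (cfg t Y) = return_pmf (cfg t' Y')"
proof -
  have "(\<lambda>i. if i < m then next_memory d \<alpha> N i (cfg t Y i) (inbox alg \<alpha> N (cfg t Y) i) else [])
      = cfg t' Y'"
    using assms(2) by (auto simp: cfg_def)
  then show ?thesis
    using mpc_round_components_algorithm[of d \<alpha> N "cfg t Y"] assms(1) by (simp add: terminated_cfg m_def)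
qed

lemma mpc_round_config: "mpc_round alg \<alpha> N (config_at t) = return_pmf (config_at (Suc t))"
proof -
  have "incoming (inbox alg \<alpha> N (cfg 2 X1) j) = J1 j" for j
    unfolding J1_def by (rule incoming_cfg) (use finite_X1 dest_less(1) in auto)
  then have 2: "mpc_round alg \<alpha> N (cfg 2 X1) = return_pmf (cfg 3 X2)"
    by (intro round_cfg) (simp_all add: next_memory_pack X2_def)
  have "incoming (inbox alg \<alpha> N (cfg 3 X2) j) = J2 j" for j
    unfolding J2_def by (rule incoming_cfg) (use finite_X2 dest_less(1) in auto)
  then have 3: "mpc_round alg \<alpha> N (cfg 3 X2) = return_pmf (cfg 4 X3)"
    by (intro round_cfg) (simp_all add: next_memory_pack X3_def)
  have "incoming (inbox alg \<alpha> N (cfg 4 X3) j) = J3 j" for j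
    unfolding J3_def by (rule incoming_cfg) (use finite_X3 dest_less(1) in auto)
  then have 4: "mpc_round alg \<alpha> N (cfg 4 X3) = return_pmf (cfg 5 X4)"
    by (intro round_cfg) (simp_all add: next_memory_pack X4_def)
  have 5: "mpc_round alg \<alpha> N (cfg 5 X4) = return_pmf (cfg 5 X4)"
    by (simp add: mpc_round_def terminated_cfg)
  show ?thesis using round_initial 2 3 4 5 by (auto simp: config_at_def numeral_eq_Suc)
qed

lemma mpc_run_config: "mpc_run alg \<alpha> N (initial_config D) t = return_pmf (config_at t)"
proof (induction t)
  case 0
  then show ?case by (simp add: config_at_def)
next
  case (Suc t)
  then show ?case by (simp add: bind_return_pmf mpc_round_config)
qed

lemma answer_final: "labels_components V E (answer alg \<alpha> N (cfg 5 X4))"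
proof -
  have "answer alg \<alpha> N (cfg 5 X4) = (\<Union>i<m. (\<lambda>w. (list_decode (w ! 0), w ! 1)) ` X4 i)"
    unfolding answer_def m_def[symmetric]
    by (intro SUP_cong) (auto simp: cfg_def result_pack set_word_list finite_X4)
  also have "\<dots> = {(v, fin (lab (list_encode v))) |v. v \<in> V}"
  proof (intro equalityI subsetI)
    fix x assume "x \<in> (\<Union>i<m. (\<lambda>w. (list_decode (w ! 0), w ! 1)) ` X4 i)"
    then obtain i w where "i < m" "w \<in> X4 i" "x = (list_decode (w ! 0), w ! 1)" by blast
    then obtain a where a: "(a, a) \<in> set (concat (map pl [0..<m]))" "x = (list_decode a, fin (lab a))"
      unfolding X4_eq[OF \<open>i < m\<close>] by force
    have "(list_encode (list_decode a), list_encode (list_decode a)) \<in> set (concat (map pl [0..<m]))"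
      using a(1) by (simp only: list_decode_inverse)
    then have "list_decode a \<in> V" by (simp only: node_in_P)
    then show "x \<in> {(v, fin (lab (list_encode v))) |v. v \<in> V}" using a(2) by force
  next
    fix x assume "x \<in> {(v, fin (lab (list_encode v))) |v. v \<in> V}"
    then obtain v where v: "v \<in> V" "x = (v, fin (lab (list_encode v)))" by blast
    let ?i = "owner (list_encode v)"
    have "[list_encode v, fin (lab (list_encode v))] \<in> X4 ?i"
      unfolding X4_eq[OF owner_less] using v(1) node_in_P by blast
    then show "x \<in> (\<Union>i<m. (\<lambda>w. (list_decode (w ! 0), w ! 1)) ` X4 i)"
      using owner_less v(2) by force
  qed
  finally show ?thesis
    using labels_componentsI[of V "\<lambda>v. fin (lab (list_encode v))" E]
    by (simp add: fin_lab_eq_iff connected_iff)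
qed

text \<open>\<open>B\<close> is the base of the word limit, \<open>e\<close> the exponent for codes
  of \<open>d\<close> coordinates, and \<open>\<kappa>\<close> the exponent for codes of words with
  up to six such entries. Both exponents depend on \<open>d\<close> only.\<close>

definition "B = graph_size V E + Max (insert 0 (\<Union>v\<in>V. set v)) + 2"
definition "e = code_exponent 1 d"
definition "\<kappa> = code_exponent e 6"
definition "W = word_limit \<kappa> V E"

section \<open>Sizes of words\<close>

lemma W_eq: "W = B ^ \<kappa>" by (simp add: W_def word_limit_def B_def)

lemma B_ge: "3 \<le> B" "m \<le> B" "N \<le> B"
  using N m_bounds(4) by (simp_all add: B_def N_def)

text \<open>The summand \<open>m\<close> leaves room for a shift \<open>r < m\<close>, so that cell
  coordinates \<open>(x + r) div m\<close> stay below \<open>B\<close> too.\<close>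

lemma coord_le: assumes "v \<in> V" "x \<in> set v" shows "x + m \<le> B"
proof -
  have "x \<le> Max (insert 0 (\<Union>v\<in>V. set v))" using assms finV by (intro Max_ge) auto
  then show ?thesis using m_bounds(4) by (simp add: B_def N_def)
qed

lemma e_ge: "5 \<le> e" using code_exponent_mono[of 1 d 1] d by (simp add: e_def)

lemma e_le_\<kappa>: "e \<le> \<kappa>" using code_exponent_mono[of 0 6 e] by (simp add: \<kappa>_def)

lemma B_e_le_W: "B ^ e \<le> W"
  unfolding W_eq using B_ge e_le_\<kappa> by (intro power_increasing) auto

lemma le_B_e: "x \<le> B \<Longrightarrow> x \<le> B ^ e"
  using power_increasing[of 1 e B] e_ge B_ge by simp

text \<open>5 is the largest phase number; the kinds end with 4.\<close>

lemma five_le: "5 \<le> B ^ e"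
proof -
  have "5 \<le> (3::nat) ^ 2" by simp
  also have "\<dots> \<le> B ^ 2" using B_ge by (intro power_mono) auto
  also have "\<dots> \<le> B ^ e" using B_ge e_ge by (intro power_increasing) auto
  finally show ?thesis .
qed

lemma code_le:
  assumes "length v \<le> d" "\<And>x. x \<in> set v \<Longrightarrow> x \<le> B"
  shows "list_encode v \<le> B ^ e"
  unfolding e_def by (rule list_encode_le_power) (use assms B_ge in auto)

lemma P_le:
  assumes "(a, b) \<in> set (concat (map pl [0..<m]))"
  shows "a \<le> B ^ e" "b \<le> B ^ e"
proof -
  have "(a, b) \<in> S" using assms by (simp only: S_def) blast
  then obtain u v where uv: "a = list_encode u" "b = list_encode v" "u \<in> V" "v \<in> V" by (rule S_D)
  have "list_encode w \<le> B ^ e" if "w \<in> V" for w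
    using coord_le[OF that] length_V[OF that] by (intro code_le) (auto intro: add_leD1)
  then show "a \<le> B ^ e" "b \<le> B ^ e" using uv by simp_all
qed

lemma entry_le:
  "i < m \<Longrightarrow> w \<in> X1 i \<union> X2 i \<union> X3 i \<union> X4 i \<Longrightarrow> x \<in> set w \<Longrightarrow> x \<le> B ^ e"
  by (rule entries_le) (use P_le le_B_e B_ge five_le in auto)

lemma word_le:
  assumes "length w \<le> 6" "\<And>x. x \<in> set w \<Longrightarrow> x \<le> B ^ e"
  shows "list_encode w \<le> W"
  unfolding W_eq \<kappa>_def by (rule list_encode_le_power) (use assms B_ge in auto)

lemma coded_word_le:
  assumes "i < m" "w \<in> X1 i \<union> X2 i \<union> X3 i \<union> X4 i"
  shows "list_encode w \<le> W" "list_encode (tl w) \<le> W"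
proof -
  note len = length_words[OF assms] and entry = entry_le[OF assms]
  show "list_encode w \<le> W" using len entry by (rule word_le)
  show "list_encode (tl w) \<le> W"
    by (rule word_le) (use len entry in \<open>cases w; auto\<close>)+
qed

text \<open>Each of the at most \<open>a\<close> words sent and \<open>b\<close> words received
  costs an address and a payload; the extra 1 is the phase number in memory.\<close>

lemma within_limits_cfg:
  assumes t: "2 \<le> t" "t < 5"
    and fin: "\<And>i. i < m \<Longrightarrow> finite (Y i)"
    and sub: "\<And>i. i < m \<Longrightarrow> Y i \<subseteq> X1 i \<union> X2 i \<union> X3 i"
    and sent: "\<And>i. i < m \<Longrightarrow> card (Y i) \<le> a"
    and rec: "\<And>i. i < m \<Longrightarrow> received m Y i \<le> b"
    and cap: "real (2 * a + 2 * b + 1) \<le> cap"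
  shows "within_limits alg \<alpha> N cap W (cfg t Y)"
proof -
  have ne: "w \<noteq> []" "hd w < m" if "i < m" "w \<in> Y i" for i w
    using dest_less[OF that(1)] sub[OF that(1)] that(2) by auto
  have word: "list_encode w \<le> W" "list_encode (tl w) \<le> W" if "i < m" "w \<in> Y i" for i w
    using coded_word_le[OF that(1)] sub[OF that(1)] that(2) by blast+
  show ?thesis
    unfolding within_limits_def m_def[symmetric]
  proof (intro allI impI conjI)
    fix i assume i: "i < m"
    have c: "cfg t Y i = pack t (Y i)" using i by (simp add: cfg_def)
    have size: "real (card (Y i) + 1) \<le> cap" using sent[OF i] cap by simp
    then show "real (length (cfg t Y i)) \<le> cap" by (simp add: c length_pack)
    show "\<forall>w\<in>set (cfg t Y i). w \<le> W"
      using word i t five_le B_e_le_W by (auto simp: c set_pack fin)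
    have "real (2 * card (Y i) + 2 * received m Y i) \<le> cap"
      using sent[OF i] rec[OF i] cap by simp
    then show "real (volume (msgs alg N i (cfg t Y i)) + volume (inbox alg \<alpha> N (cfg t Y) i)) \<le> cap"
      using i t ne(1) by (simp add: msgs_cfg incoming_cfg fin volume_outgoing)
    show "\<forall>(k, p)\<in>set (msgs alg N i (cfg t Y i)). k < m \<and> (\<forall>w\<in>set p. w \<le> W)"
      using i t ne(2) word(2) by (auto simp: msgs_cfg outgoing_pack set_word_list fin)
  next
    fix i L assume i: "i < m" and "result alg N i (cfg t Y i) = Some L"
    then have False using t by (simp add: cfg_def result_pack)
    then show "real (\<Sum>(v, a)\<leftarrow>L. length v + 1) \<le> cap"
      "\<forall>(v, a)\<in>set L. a \<le> W \<and> (\<forall>w\<in>set v. w \<le> W)" by blast+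
  qed
qed

lemma within_limits_final:
  assumes cap: "real ((d + 1) * load + 1) \<le> cap"
  shows "within_limits alg \<alpha> N cap W (cfg 5 X4)"
  unfolding within_limits_def m_def[symmetric]
proof (intro allI impI conjI)
  fix i assume i: "i < m"
  have c: "cfg 5 X4 i = pack 5 (X4 i)" using i by (simp add: cfg_def)
  have "card (X4 i) + 1 \<le> (d + 1) * load + 1" using card_X4[OF i] by simp
  then show "real (length (cfg 5 X4 i)) \<le> cap" using cap unfolding c length_pack by linarith
  show "\<forall>w\<in>set (cfg 5 X4 i). w \<le> W"
    using coded_word_le(1)[OF i] five_le B_e_le_W by (auto simp: c set_pack finite_X4 i)
next
  fix i assume "\<not> terminated alg \<alpha> N (cfg 5 X4)"
  then show "real (volume (msgs alg N i (cfg 5 X4 i)) + volume (inbox alg \<alpha> N (cfg 5 X4) i)) \<le> cap"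
    and "\<forall>(k, p)\<in>set (msgs alg N i (cfg 5 X4 i)). k < m \<and> (\<forall>w\<in>set p. w \<le> W)"
    by (simp_all add: terminated_cfg)
next
  fix i L assume i: "i < m" and L: "result alg N i (cfg 5 X4 i) = Some L"
  define f where "f = (\<lambda>w. (list_decode (w ! 0), w ! 1 :: nat))"
  have L: "L = map f (word_list (X4 i))" using L i by (simp add: cfg_def result_pack f_def)
  have elem: "length v = d \<and> (\<forall>x\<in>set v. x \<le> W) \<and> a \<le> W" if va: "(v, a) \<in> set L" for v a
  proof -
    from va obtain w where w: "w \<in> X4 i" "(v, a) = f w"
      by (auto simp: L set_word_list finite_X4 i)
    then obtain b where b: "(b, b) \<in> set (concat (map pl [0..<m]))" "w = [b, fin (lab b)]"
      unfolding X4_eq[OF i] by blast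
    have "(list_encode (list_decode b), list_encode (list_decode b)) \<in> set (concat (map pl [0..<m]))"
      using b(1) by (simp only: list_decode_inverse)
    then have "list_decode b \<in> V" by (simp only: node_in_P)
    then have v: "v \<in> V" using w(2) b(2) by (simp add: f_def)
    have "a \<le> B ^ e" using entry_le[OF i, of w a] w b(2) by (simp add: f_def)
    moreover have "x \<le> B ^ e" if "x \<in> set v" for x
      using coord_le[OF v that] by (intro le_B_e) simp
    ultimately show ?thesis using length_V[OF v] B_e_le_W by fastforce
  qed
  then show "\<forall>(v, a)\<in>set L. a \<le> W \<and> (\<forall>w\<in>set v. w \<le> W)" by auto
  have "(\<Sum>(v, a)\<leftarrow>L. length v + 1) = (\<Sum>x\<leftarrow>L. d + 1)"
    by (rule arg_cong[where f = sum_list], rule map_cong) (use elem in auto)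
  also have "\<dots> = length L * (d + 1)" by (simp add: sum_list_triv)
  also have "length L = card (X4 i)" by (simp add: L length_word_list)
  also have "card (X4 i) * (d + 1) \<le> load * (d + 1)" using card_X4[OF i] by (rule mult_le_mono1)
  finally have "(\<Sum>(v, a)\<leftarrow>L. length v + 1) \<le> (d + 1) * load + 1" by (simp add: mult.commute)
  then show "real (\<Sum>(v, a)\<leftarrow>L. length v + 1) \<le> cap" using cap by linarith
qed

lemma stats_le:
  assumes "i < m" "x \<in> set (stats (cell_code m) m (sample_step \<alpha> N) (pl i))"
  shows "x \<le> B ^ e"
proof -
  have "cut (cell_code m) (pl i) r \<le> B ^ e" for r
  proof -
    have "cut (cell_code m) (pl i) r \<le> length (pl i)" unfolding cut_def by (rule length_filter_le)
    also have "\<dots> \<le> N" using len[OF assms(1)] share_bounds(3)[OF N \<alpha>0 \<alpha>(3)] by simp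
    finally show ?thesis using le_B_e B_ge by simp
  qed
  moreover have key: "k \<le> B ^ e" if k: "k \<in> set (cell_keys (cell_code m) (pl i) r)" and r: "r < m" for k r
  proof -
    have "k \<in> (\<lambda>p. cell_code m r (fst p)) ` set (pl i) \<union> (\<lambda>p. cell_code m r (snd p)) ` set (pl i)"
      using k by (simp add: cell_keys_def)
    then obtain p where p: "p \<in> set (pl i)" "k = cell_code m r (fst p) \<or> k = cell_code m r (snd p)"
      by blast
    have "(fst p, snd p) \<in> S" using pl_P[OF assms(1) p(1)] by (simp only: S_def prod.collapse) blast
    then obtain u v where "fst p = list_encode u" "snd p = list_encode v" "u \<in> V" "v \<in> V"
      by (rule S_D)
    with p(2) obtain u where u: "u \<in> V" "k = list_encode (map (\<lambda>x. (x + r) div m) u)"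
      by (auto simp: cell_code_list_encode)
    have "(x + r) div m \<le> B" if "x \<in> set u" for x
      using coord_le[OF u(1) that] r div_le_dividend[of "x + r" m] by linarith
    then show ?thesis unfolding u(2) using length_V[OF u(1)] by (intro code_le) auto
  qed
  moreover have "sample q (cell_keys (cell_code m) (pl i) r) t \<le> B ^ e" if "r < m" for q r t
    using key[OF nth_mem that, of "t * q"] by (simp add: sample_def)
  moreover have "y div (m + 1) < m" if "y < m * (m + 1)" for y
    using that by (simp add: less_mult_imp_div_less)
  ultimately show ?thesis using assms(2) by (auto simp: stats_def Let_def split: if_splits)
qed

text \<open>An item takes at most \<open>2 * d + 1\<close> words. The statistics cost
  \<open>m * (m * (m + 1) + 1) <= 3 * m ^ 3\<close> for sending and the same again for
  receiving.\<close>

lemma within_limits_initial: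
  assumes cap: "real ((2 * d + 1) * share \<alpha> N + 6 * m ^ 3) \<le> cap"
  shows "within_limits alg \<alpha> N cap W (initial_config D)"
  unfolding within_limits_def m_def[symmetric]
proof (intro allI impI conjI)
  fix i assume i: "i < m"
  have words: "length (item_words it) \<le> 2 * d + 1" if "it \<in> set (D i)" for it
    using length_item_words[of it] ends_V[OF D_items[OF i that]] by (simp add: length_V)
  have "length (initial_config D i) \<le> length (D i) * (2 * d + 1)"
    unfolding initial_config_def length_concat
    using sum_list_mono[of "D i" "\<lambda>it. length (item_words it)" "\<lambda>_. 2 * d + 1"] words
    by (simp add: o_def sum_list_triv)
  also have "\<dots> \<le> share \<alpha> N * (2 * d + 1)" using length_D[OF i] by (rule mult_le_mono1)
  finally have "length (initial_config D i) \<le> (2 * d + 1) * share \<alpha> N + 6 * m ^ 3"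
    by (simp add: mult.commute)
  then show "real (length (initial_config D i)) \<le> cap" using cap by linarith
  have "x \<le> B ^ e" if it: "it \<in> set (D i)" and x: "x \<in> set (item_words it)" for it x
  proof -
    have "x \<le> 1 \<or> (\<exists>v\<in>V. x \<in> set v)"
      using x set_item_words[of it] ends_V[OF D_items[OF i it]] by fastforce
    then show ?thesis using five_le coord_le le_B_e by (meson add_leD1 le_trans one_le_numeral)
  qed
  then show "\<forall>w\<in>set (initial_config D i). w \<le> W"
    using B_e_le_W by (fastforce simp: initial_config_def)
  let ?st = "\<lambda>i. stats (cell_code m) m (sample_step \<alpha> N) (pl i)"
  have out: "volume (msgs alg N i (initial_config D i)) = m * (m * (m + 1) + 1)"
    unfolding msgs_initial volume_map_const[where g = "\<lambda>j. j"]
    by (simp add: length_stats sum_list_triv)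
  have inb: "volume (inbox alg \<alpha> N (initial_config D) i) = m * (m * (m + 1) + 1)"
    unfolding inbox_initial[OF i] volume_map_const[where g = "\<lambda>j. j"]
    by (simp add: length_stats sum_list_triv)
  have "m * (m * (m + 1) + 1) \<le> 3 * m ^ 3"
  proof -
    have "m \<le> m * m" "m * m \<le> m * m * m" using m_bounds(3) by simp_all
    moreover have "m * (m * (m + 1) + 1) = m * m * m + m * m + m" by (simp add: algebra_simps)
    ultimately show ?thesis unfolding power3_eq_cube by linarith
  qed
  then show "real (volume (msgs alg N i (initial_config D i))
      + volume (inbox alg \<alpha> N (initial_config D) i)) \<le> cap"
    using cap unfolding out inb by linarith
  show "\<forall>(k, p)\<in>set (msgs alg N i (initial_config D i)). k < m \<and> (\<forall>w\<in>set p. w \<le> W)"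
    using stats_le[OF i] B_e_le_W by (fastforce simp: msgs_initial)
next
  fix i L assume "i < m" "result alg N i (initial_config D i) = Some L"
  then have False by (simp add: result_fresh fresh_initial)
  then show "real (\<Sum>(v, a)\<leftarrow>L. length v + 1) \<le> cap"
    "\<forall>(v, a)\<in>set L. a \<le> W \<and> (\<forall>w\<in>set v. w \<le> W)" by blast+
qed

text \<open>\<open>(d + 1) * load\<close> covers the output, that is \<open>d\<close> coordinates
  and a label per node. The remaining \<open>4 * load\<close> and the \<open>8 * crossing\<close>
  cover \<open>2 * crossing + load\<close> messages sent and as many received, at two words
  each.\<close>

definition "size_bound = (2 * d + 1) * share \<alpha> N + 6 * m ^ 3 + (d + 5) * load + 8 * crossing + 1"

lemma within_limits_config:
  assumes cap: "real size_bound \<le> cap"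
  shows "within_limits alg \<alpha> N cap W (config_at t)"
proof -
  define x y z where "x = (2 * d + 1) * share \<alpha> N" and "y = (d + 1) * load" and "z = m ^ 3"
  note folds = x_def[symmetric] y_def[symmetric] z_def[symmetric]
  have "(d + 5) * load = y + 4 * load" by (simp add: y_def algebra_simps)
  then have size: "size_bound = x + 6 * z + (y + 4 * load) + 8 * crossing + 1"
    by (simp only: size_bound_def folds)
  \<comment> \<open>The first routing sends up to \<open>2 * share\<close> messages of two words;
    for \<open>d >= 2\<close> the term for the input absorbs them.\<close>
  have "5 * share \<alpha> N \<le> x" unfolding x_def using d by (intro mult_right_mono) auto
  then have lims: "2 * (2 * share \<alpha> N) + 2 * load + 1 \<le> size_bound"
    "2 * (2 * crossing + load) + 2 * (2 * crossing + load) + 1 \<le> size_bound"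
    "(d + 1) * load + 1 \<le> size_bound" "(2 * d + 1) * share \<alpha> N + 6 * m ^ 3 \<le> size_bound"
    unfolding size folds by simp_all
  have "within_limits alg \<alpha> N cap W (initial_config D)"
    by (rule within_limits_initial) (use lims(4) cap in linarith)
  moreover have "within_limits alg \<alpha> N cap W (cfg 2 X1)"
    by (rule within_limits_cfg[OF _ _ _ _ card_X1 received_X1])
      (use lims(1) cap finite_X1 in \<open>auto simp del: of_nat_add of_nat_mult\<close>)
  moreover have "within_limits alg \<alpha> N cap W (cfg 3 X2)"
    by (rule within_limits_cfg[OF _ _ _ _ card_X2 received_X2])
      (use lims(2) cap finite_X2 in \<open>auto simp del: of_nat_add of_nat_mult\<close>)
  moreover have "within_limits alg \<alpha> N cap W (cfg 4 X3)"
    by (rule within_limits_cfg[OF _ _ _ _ card_X3 received_X3])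
      (use lims(2) cap finite_X3 in \<open>auto simp del: of_nat_add of_nat_mult\<close>)
  moreover have "within_limits alg \<alpha> N cap W (cfg 5 X4)"
    by (rule within_limits_final) (use lims(3) cap in linarith)
  ultimately show ?thesis by (simp add: config_at_def)
qed

end

text \<open>Obtained from \<open>size_bound\<close> in units of \<open>s\<close>: a share is at most
  \<open>2 s\<close>, and \<open>6 m^3\<close> at most \<open>48 s\<close>. Since
  \<open>m * sample_step\<close> is at most \<open>2 share + m\<close>, thus at most
  \<open>4 s + 8 s\<close>, the term \<open>2 * m * q\<close> of \<open>load\<close> contributes
  24.\<close>

definition space_factor :: "nat \<Rightarrow> nat \<Rightarrow> real" where
  "space_factor d c = 2 * (2 * d + 1) + 48 + (d + 5) * (24 + 2 * (2 ^ d * (2 * c + 1) ^ d)) + 8 * (d * c) + 1"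

lemma space_factor_pos: "0 < space_factor d c"
  unfolding space_factor_def of_nat_0_less_iff by simp

context components_instance
begin

lemma size_bound_le: "real size_bound \<le> space_factor d c * local_space \<alpha> N"
proof -
  define s where "s = local_space \<alpha> N"
  define G :: real where "G = 2 ^ d * (2 * c + 1) ^ d"
  have s1: "1 \<le> s" using N \<alpha>0 by (simp add: s_def local_space_def ge_one_powr_ge_zero)
  have share: "real (share \<alpha> N) \<le> 2 * s" using share_bounds(2)[OF N \<alpha>0 \<alpha>(3)] by (simp add: s_def)
  have m3: "real (m ^ 3) \<le> 8 * s"
    using num_machines_power_le[OF N \<alpha>0 \<alpha>(3), of 3] \<alpha>(1) by (simp add: s_def m_def)
  have "m * 1 \<le> m * m ^ 2" using m_bounds(3) by (intro mult_left_mono) auto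
  then have "m \<le> m ^ 3" by (simp add: power3_eq_cube power2_eq_square mult.assoc)
  then have m: "real m \<le> 8 * s" using m3 by linarith
  \<comment> \<open>From \<open>d + 1 < \<alpha> (d + 2)\<close> follows
    \<open>d (1 - \<alpha>) < 2 \<alpha> - 1\<close>, which is less than
    \<open>\<alpha>\<close>.\<close>
  have "real d * (1 - \<alpha>) \<le> \<alpha>"
  proof -
    have "real d + 1 < \<alpha> * (real d + 2)" using \<alpha>(2) by (simp add: divide_less_eq)
    then show ?thesis using \<alpha>(3) by (simp add: algebra_simps)
  qed
  then have "real (m ^ d) \<le> 2 ^ d * s"
    using num_machines_power_le[OF N \<alpha>0 \<alpha>(3), of d] by (simp add: s_def m_def)
  then have "real (m ^ d) * real ((2 * c + 1) ^ d) \<le> 2 ^ d * s * real ((2 * c + 1) ^ d)"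
    by (rule mult_right_mono) simp
  then have M: "real (m ^ d * (2 * c + 1) ^ d) \<le> G * s"
    by (simp add: G_def mult_ac)
  have "m * sample_step \<alpha> N \<le> 2 * share \<alpha> N + m"
    by (simp add: sample_step_def m_def[symmetric] add_mult_distrib2)
  then have "real (m * sample_step \<alpha> N) \<le> 12 * s" using share m by linarith
  then have load: "real load \<le> (24 + 2 * G) * s"
    using M unfolding load_def by (simp add: algebra_simps)
  have cr: "real crossing \<le> d * c * s"
  proof -
    have "crossing * m \<le> d * c * N" using crossing_le unfolding card_P .
    then have "real crossing * real m \<le> real (d * c) * real N"
      by (metis of_nat_le_iff of_nat_mult)
    then have "real crossing \<le> real (d * c) * (real N / real m)"
      using m_bounds(3) by (simp add: field_simps)
    also have "\<dots> \<le> real (d * c) * s"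
      using share_bounds(1)[OF N \<alpha>0 \<alpha>(3)] by (intro mult_left_mono) (simp_all add: s_def m_def)
    finally show ?thesis by simp
  qed
  have 1: "real ((2 * d + 1) * share \<alpha> N) \<le> (2 * (2 * d + 1)) * s"
    using mult_left_mono[OF share, of "real (2 * d + 1)"] by (simp add: algebra_simps)
  have 2: "real ((d + 5) * load) \<le> ((d + 5) * (24 + 2 * G)) * s"
    using mult_left_mono[OF load, of "real (d + 5)"] by (simp add: algebra_simps)
  have "real size_bound = real ((2 * d + 1) * share \<alpha> N) + 6 * real (m ^ 3) + real ((d + 5) * load) + 8 * real crossing + 1"
    unfolding size_bound_def by simp
  also have "\<dots> \<le> (2 * (2 * d + 1)) * s + 6 * (8 * s) + ((d + 5) * (24 + 2 * G)) * s + 8 * (d * c * s) + s"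
    using 1 2 m3 cr s1 by linarith
  also have "\<dots> = space_factor d c * s"
    unfolding space_factor_def G_def by (simp add: distrib_right)
  finally show ?thesis by (simp add: s_def)
qed

lemma respects_limits_alg: "respects_limits alg \<alpha> (space_factor d c) \<kappa> V E D"
  using within_limits_config[OF size_bound_le]
  by (simp add: respects_limits_def Let_def mpc_run_config W_def flip: N_def)

lemma las_vegas_alg: "las_vegas_components alg \<alpha> V E D"
proof -
  have "labels_components V E (answer alg \<alpha> N (config_at t))"
    if "terminated alg \<alpha> N (config_at t)" for t
    using that not_terminated_initial answer_final
    by (auto simp: config_at_def terminated_cfg split: if_splits)
  then show ?thesis
    by (simp add: las_vegas_components_def Let_def mpc_run_config flip: N_def)
qed

lemma success_prob_alg: "success_prob alg \<alpha> V E D 4 = 1"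
  using answer_final
  by (simp add: success_prob_def Let_def mpc_run_config config_at_def terminated_cfg flip: N_def)

end

text \<open>A node has at most \<open>(2 * c + 1) ^ d\<close> neighbours, so the input size is
  linear in the number of nodes. This turns the local memory into one of order
  \<open>card V powr \<alpha>\<close>.\<close>

lemma graph_size_bounds:
  assumes grid: "grid_graph d c V E" and d: "0 < d"
  shows "card V \<le> graph_size V E" "graph_size V E \<le> (1 + (2 * c + 1) ^ d) * card V"
proof -
  show "card V \<le> graph_size V E" by (simp add: graph_size_def)
  define B where "B u = {v :: point. length v = d \<and> (\<forall>k<d. \<bar>int (u ! k) - int (v ! k)\<bar> \<le> int c)}"
    for u :: point
  have V: "finite V" "\<And>v. v \<in> V \<Longrightarrow> length v = d" using grid by (auto simp: grid_graph_def)
  have B: "finite (B u)" "card (B u) \<le> (2 * c + 1) ^ d" if "u \<in> V" for u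
    using card_neighbours_le[of u d c] V(2)[OF that] by (auto simp: B_def)
  have fin: "finite (Sigma V B)" using V(1) B(1) by auto
  have "E \<subseteq> (\<lambda>(u, v). {u, v}) ` Sigma V B"
  proof
    fix x assume "x \<in> E"
    then obtain u v where uv: "u \<in> V" "v \<in> V" "x = {u, v}" "linf_dist d u v \<le> int c"
      using grid unfolding grid_graph_def by blast
    then have "(u, v) \<in> near d c" by (intro linf_dist_near V(2))
    then have "v \<in> B u" by (simp add: near_def B_def)
    with uv show "x \<in> (\<lambda>(u, v). {u, v}) ` Sigma V B" by auto
  qed
  from surj_card_le[OF fin this] have "card E \<le> card (Sigma V B)" .
  also have "\<dots> = (\<Sum>u\<in>V. card (B u))" using V(1) B(1) by (simp add: card_SigmaI)
  also have "\<dots> \<le> card V * (2 * c + 1) ^ d"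
    using sum_bounded_above[of V "\<lambda>u. card (B u)" "(2 * c + 1) ^ d"] B(2) by simp
  finally show "graph_size V E \<le> (1 + (2 * c + 1) ^ d) * card V"
    by (simp add: graph_size_def algebra_simps)
qed

text \<open>Without input there are no machines, hence every configuration counts as terminated,
  with the empty answer, which is right for the empty graph.\<close>

lemma empty_instance:
  assumes "grid_graph d c V E" "graph_size V E = 0"
  shows "respects_limits A \<alpha> C \<kappa> V E D" "las_vegas_components A \<alpha> V E D" "success_prob A \<alpha> V E D R = 1"
proof -
  have m0: "num_machines \<alpha> 0 = 0" by (simp add: num_machines_def)
  have "V = {}" using assms by (auto simp: grid_graph_def graph_size_def)
  then have "labels_components V E {}"
    by (auto simp: labels_components_def connected_components_def)
  then have lab: "labels_components V E (answer A \<alpha> 0 \<sigma>)" for \<sigma> by (simp add: answer_def m0)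
  have ter: "terminated A \<alpha> 0 \<sigma>" for \<sigma> by (simp add: terminated_def m0)
  show "respects_limits A \<alpha> C \<kappa> V E D" by (simp add: respects_limits_def assms(2) within_limits_def m0)
  show "las_vegas_components A \<alpha> V E D" by (simp add: las_vegas_components_def assms(2) lab)
  show "success_prob A \<alpha> V E D R = 1" by (simp add: success_prob_def assms(2) lab ter)
qed

theorem theorem1:
  fixes d c :: nat and \<alpha> :: real
  assumes "2 \<le> d" and "1 \<le> c"
    and "max ((real d + 1) / (real d + 2)) (4 / 5) < \<alpha>" and "\<alpha> < 1"
  shows "\<exists>(A :: mpc_algorithm) (C :: real) (\<kappa> :: nat) (R :: nat) (\<epsilon> :: real).
           0 < C \<and> 0 < \<epsilon> \<and>
           (\<exists>a>0. \<exists>b>0. \<forall>V E. grid_graph d c V E \<longrightarrow>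
              a * real (card V) powr \<alpha> \<le> C * local_space \<alpha> (graph_size V E) \<and>
              C * local_space \<alpha> (graph_size V E) \<le> b * real (card V) powr \<alpha>) \<and>
           (\<forall>V E D. grid_graph d c V E \<and> even_distribution \<alpha> V E D \<longrightarrow>
              respects_limits A \<alpha> C \<kappa> V E D \<and>
              las_vegas_components A \<alpha> V E D \<and>
              success_prob A \<alpha> V E D R \<ge> 1 - 1 / real (graph_size V E) powr \<epsilon>)"
proof -
  let ?A = "components_algorithm d \<alpha>" and ?C = "space_factor d c"
    and ?\<kappa> = "code_exponent (code_exponent 1 d) 6" and ?K = "1 + (2 * c + 1) ^ d"
  have \<alpha>: "0 \<le> \<alpha>" "3 / 4 \<le> \<alpha>" "(real d + 1) / (real d + 2) < \<alpha>" using assms(3) by auto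
  have "?C * real (card V) powr \<alpha> \<le> ?C * local_space \<alpha> (graph_size V E) \<and>
      ?C * local_space \<alpha> (graph_size V E) \<le> (?C * real ?K powr \<alpha>) * real (card V) powr \<alpha>"
    if "grid_graph d c V E" for V E
  proof -
    have size: "card V \<le> graph_size V E" "graph_size V E \<le> ?K * card V"
      using graph_size_bounds[OF that] assms(1) by auto
    have "real (card V) powr \<alpha> \<le> local_space \<alpha> (graph_size V E)"
      unfolding local_space_def using size(1) \<alpha> by (intro powr_mono2) auto
    moreover have "local_space \<alpha> (graph_size V E) \<le> real (?K * card V) powr \<alpha>"
      unfolding local_space_def using size(2) \<alpha> by (intro powr_mono2) (auto simp only: of_nat_le_iff of_nat_0_le_iff)
    moreover have "real (?K * card V) powr \<alpha> = real ?K powr \<alpha> * real (card V) powr \<alpha>"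
      unfolding of_nat_mult by (rule powr_mult)
    ultimately show ?thesis
      using space_factor_pos[of d c] by (auto simp: mult.assoc intro!: mult_left_mono)
  qed
  moreover have "0 < ?C * real ?K powr \<alpha>"
  proof -
    have "real ?K \<noteq> 0" unfolding of_nat_eq_0_iff by simp
    from mult_pos_pos[OF space_factor_pos iffD2[OF powr_gt_zero this]] show ?thesis .
  qed
  ultimately have "\<exists>a>0. \<exists>b>0. \<forall>V E. grid_graph d c V E \<longrightarrow>
              a * real (card V) powr \<alpha> \<le> ?C * local_space \<alpha> (graph_size V E) \<and>
              ?C * local_space \<alpha> (graph_size V E) \<le> b * real (card V) powr \<alpha>"
    using space_factor_pos[of d c] by blast
  moreover have "respects_limits ?A \<alpha> ?C ?\<kappa> V E D \<and> las_vegas_components ?A \<alpha> V E D \<and>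
      success_prob ?A \<alpha> V E D 4 = 1"
    if "grid_graph d c V E" "even_distribution \<alpha> V E D" for V E D
  proof (cases "graph_size V E = 0")
    case True
    then show ?thesis using empty_instance[OF that(1)] by blast
  next
    case False
    then interpret components_instance d c \<alpha> V E D
      using that \<alpha> assms by unfold_locales auto
    show ?thesis
      using respects_limits_alg las_vegas_alg success_prob_alg by (simp add: \<kappa>_def e_def)
  qed
  \<comment> \<open>The witness 4 is the number of rounds. Success is certain after them, so any
    positive \<open>\<epsilon>\<close> would serve; it is set to 1.\<close>
  ultimately show ?thesis
    using space_factor_pos[of d c]
    by (intro exI[of _ ?A] exI[of _ ?C] exI[of _ ?\<kappa>] exI[of _ 4] exI[of _ 1]) auto
qed

end
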